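(* There is (in $\mathrm{ZFC}$) a compact $T_2$ space $X$ such that $X$ is destructible and such that, if the Continuum Hypothesis holds, then $X$ satisfies $\mathsf{S}_1^{\omega_1}(\mathcal{O}_X,\mathcal{O}_X)$.
   Context: A forcing notion $\mathbb P$ is countably closed if every decreasing sequence in $\mathbb P$ indexed by a countable ordinal has a lower bound in $\mathbb P$. If $\langle X,\mathcal T\rangle$ is a topological space in the ground model, then in a forcing extension $X$ is regarded as a space with the topology that has $\mathcal T$ as an open base. A Lindelöf space is indestructible if it remains Lindelöf (in this sense) in every forcing extension by a countably closed forcing notion; a Lindelöf space that is not indestructible is called destructible. $\mathsf{S}_1^{\omega_1}(\mathcal{O}_X,\mathcal{O}_X)$ is the statement: for every sequence $(\mathcal U_\xi)_{\xi\in\omega_1}$ of open covers of $X$ there is a sequence $(U_\xi)_{\xi\in\omega_1}$ with $U_\xi\in\mathcal U_\xi$ for each $\xi\in\omega_1$ and $X=\bigcup\{U_\xi:\xi\in\omega_1\}$. *)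

theory Defs
  imports "HOL-Analysis.Analysis"
begin

section \<open>The selection principle and the Continuum Hypothesis\<close>

unbundle cardinal_syntax

text \<open>\<^term>\<open>cardSuc natLeq\<close> is the initial ordinal of cardinality aleph one; its field plays the
  role of the index set.\<close>

definition omega1 :: "nat set set" where
  "omega1 = Field (cardSuc natLeq)"

definition CH :: bool where
  "CH \<longleftrightarrow> |UNIV :: real set| =o cardSuc natLeq"

unbundle no cardinal_syntax

definition open_cover :: "'a topology \<Rightarrow> 'a set set \<Rightarrow> bool" where
  "open_cover X \<U> \<longleftrightarrow> (\<forall>U\<in>\<U>. openin X U) \<and> \<Union>\<U> = topspace X"

definition S1_omega1 :: "'a topology \<Rightarrow> bool" where
  "S1_omega1 X \<longleftrightarrow>
    (\<forall>\<U> :: nat set \<Rightarrow> 'a set set. (\<forall>\<xi>\<in>omega1. open_cover X (\<U> \<xi>)) \<longrightarrow>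
      (\<exists>U. (\<forall>\<xi>\<in>omega1. U \<xi> \<in> \<U> \<xi>) \<and> topspace X = (\<Union>\<xi>\<in>omega1. U \<xi>)))"


section \<open>Countably closed forcing notions\<close>

text \<open>A forcing notion is given by its order relation \<open>r\<close>, the set of conditions being
  \<^term>\<open>Field r\<close>; \<open>(q, p) \<in> r\<close> means that \<open>q\<close> is stronger than (or equal to) \<open>p\<close>.\<close>

definition forcing_notion :: "'p rel \<Rightarrow> bool" where
  "forcing_notion r \<longleftrightarrow> Preorder r \<and> Field r \<noteq> {}"

text \<open>Countable ordinals are represented by the well-orders on sets of natural numbers; the
  sequence \<open>f\<close> is indexed by \<^term>\<open>Field w\<close>.\<close>

definition countably_closed :: "'p rel \<Rightarrow> bool" where
  "countably_closed r \<longleftrightarrow>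
    (\<forall>(w :: nat rel) f. Well_order w \<longrightarrow>
      (\<forall>i\<in>Field w. f i \<in> Field r) \<longrightarrow>
      (\<forall>i j. (i, j) \<in> w \<longrightarrow> (f j, f i) \<in> r) \<longrightarrow>
      (\<exists>p\<in>Field r. \<forall>i\<in>Field w. (p, f i) \<in> r))"


section \<open>The forcing relation\<close>

text \<open>
  The ground model is the universe of HOL, so a generic extension is accessible only through
  its forcing relation. A statement \<open>\<phi>\<close> of the forcing language is represented by the relation
  \<open>\<phi> r p\<close>, read ``\<open>p\<close> forces \<open>\<phi>\<close> with respect to the forcing notion \<open>r\<close>''. The primitive
  connectives are negation, conjunction and universal quantification, with the usual clauses;
  the others are their classical abbreviations.

  Quantifiers range over HOL types. When that type is a type of ground-model objects, the
  quantifier ranges in the extension over (the canonical names of) these objects; when it is a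
  type of names, it ranges over all the objects of the extension that have such a name.
\<close>

type_synonym 'p fml = "'p rel \<Rightarrow> 'p \<Rightarrow> bool"

definition fNot :: "'p fml \<Rightarrow> 'p fml" ("\<^bold>\<not> _" [40] 40) where
  "(\<^bold>\<not> \<phi>) r p \<longleftrightarrow> (\<forall>q. (q, p) \<in> r \<longrightarrow> \<not> \<phi> r q)"

definition fAnd :: "'p fml \<Rightarrow> 'p fml \<Rightarrow> 'p fml" (infixr "\<^bold>\<and>" 35) where
  "(\<phi> \<^bold>\<and> \<psi>) r p \<longleftrightarrow> \<phi> r p \<and> \<psi> r p"

definition fAll :: "('x \<Rightarrow> 'p fml) \<Rightarrow> 'p fml" (binder "\<^bold>\<forall>" 10) where
  "(\<^bold>\<forall>x. \<phi> x) r p \<longleftrightarrow> (\<forall>x. \<phi> x r p)"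

definition fImp :: "'p fml \<Rightarrow> 'p fml \<Rightarrow> 'p fml" (infixr "\<^bold>\<longrightarrow>" 25) where
  "(\<phi> \<^bold>\<longrightarrow> \<psi>) = (\<^bold>\<not> (\<phi> \<^bold>\<and> \<^bold>\<not> \<psi>))"

definition fIff :: "'p fml \<Rightarrow> 'p fml \<Rightarrow> 'p fml" (infixr "\<^bold>\<longleftrightarrow>" 25) where
  "(\<phi> \<^bold>\<longleftrightarrow> \<psi>) = ((\<phi> \<^bold>\<longrightarrow> \<psi>) \<^bold>\<and> (\<psi> \<^bold>\<longrightarrow> \<phi>))"

definition fEx :: "('x \<Rightarrow> 'p fml) \<Rightarrow> 'p fml" (binder "\<^bold>\<exists>" 10) where
  "(\<^bold>\<exists>x. \<phi> x) = (\<^bold>\<not> (\<^bold>\<forall>x. \<^bold>\<not> \<phi> x))"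

text \<open>An atomic statement \<open>b\<close> about ground-model objects is forced iff it is true.\<close>

definition fGround :: "bool \<Rightarrow> 'p fml" where
  "fGround b r p \<longleftrightarrow> b"

text \<open>
  A name for a set is a set of pairs \<open>(t, c)\<close> of a name \<open>t\<close> and a condition \<open>c\<close>, with value
  \<open>{t\<^sup>G | (t, c). c \<in> G}\<close> for a generic filter \<open>G\<close>. Two levels are needed:
  \<^item> \<open>('a, 'p) name\<close>: sets of ground-model objects of type \<open>'a\<close>, which serve as canonical
    names of themselves;
  \<^item> \<open>(('a, 'p) name, 'p) name\<close>: families of such sets.

  Every set, respectively family of sets, of ground-model objects of type \<open>'a\<close> in the extension
  has a name of this form (a nice name), so quantifying over these types of names is
  quantifying over all such sets and families of the extension.

  In \<open>fIn E s N\<close>, the parameter \<open>E\<close> is the (forced) equality of the members.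
\<close>

type_synonym ('t, 'p) name = "('t \<times> 'p) set"

definition fIn :: "('t \<Rightarrow> 't \<Rightarrow> 'p fml) \<Rightarrow> 't \<Rightarrow> ('t, 'p) name \<Rightarrow> 'p fml" where
  "fIn E s N r p \<longleftrightarrow>
    (\<forall>q. (q, p) \<in> r \<longrightarrow>
      (\<exists>q'. (q', q) \<in> r \<and> (\<exists>(t, c)\<in>N. (q', c) \<in> r \<and> E s t r q')))"

definition fElem :: "'a \<Rightarrow> ('a, 'p) name \<Rightarrow> 'p fml" (infix "\<^bold>\<in>" 50) where
  "(x \<^bold>\<in> W) = fIn (\<lambda>x y. fGround (x = y)) x W"

definition fEq :: "('a, 'p) name \<Rightarrow> ('a, 'p) name \<Rightarrow> 'p fml" (infix "\<^bold>=" 50) where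
  "(V \<^bold>= W) = (\<^bold>\<forall>x. x \<^bold>\<in> V \<^bold>\<longleftrightarrow> x \<^bold>\<in> W)"

definition fMember :: "('a, 'p) name \<Rightarrow> (('a, 'p) name, 'p) name \<Rightarrow> 'p fml"
    (infix "\<^bold>\<in>\<^bold>\<in>" 50) where
  "(W \<^bold>\<in>\<^bold>\<in> \<U>) = fIn fEq W \<U>"


section \<open>The Lindelof property in the extension and indestructibility\<close>

text \<open>The open sets of the extension are the unions of families \<open>S\<close>, lying in the extension,
  of ground-model open sets: the old topology is a base of the new one.\<close>

definition fOpenin :: "'a topology \<Rightarrow> ('a, 'p) name \<Rightarrow> 'p fml" where
  "fOpenin X W =
    (\<^bold>\<exists>S :: ('a set, 'p) name.
      (\<^bold>\<forall>B. B \<^bold>\<in> S \<^bold>\<longrightarrow> fGround (openin X B)) \<^bold>\<and>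
      (\<^bold>\<forall>x. x \<^bold>\<in> W \<^bold>\<longleftrightarrow> (\<^bold>\<exists>B. B \<^bold>\<in> S \<^bold>\<and> fGround (x \<in> B))))"

definition fOpen_cover :: "'a topology \<Rightarrow> (('a, 'p) name, 'p) name \<Rightarrow> 'p fml" where
  "fOpen_cover X \<U> =
    ((\<^bold>\<forall>W. W \<^bold>\<in>\<^bold>\<in> \<U> \<^bold>\<longrightarrow> fOpenin X W) \<^bold>\<and>
     (\<^bold>\<forall>x. fGround (x \<in> topspace X) \<^bold>\<longleftrightarrow> (\<^bold>\<exists>W. W \<^bold>\<in>\<^bold>\<in> \<U> \<^bold>\<and> x \<^bold>\<in> W)))"

text \<open>A sequence \<open>f\<close> of names, indexed by the natural numbers, is a name for the sequence of
  their values, and every sequence in the extension of sets of ground-model objects arises in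
  this way. Countability of \<open>\<V>\<close> says that such a sequence runs through all members of \<open>\<V>\<close>.\<close>

definition fCountable :: "(('a, 'p) name, 'p) name \<Rightarrow> 'p fml" where
  "fCountable \<V> =
    (\<^bold>\<exists>f :: nat \<Rightarrow> ('a, 'p) name. \<^bold>\<forall>W. W \<^bold>\<in>\<^bold>\<in> \<V> \<^bold>\<longrightarrow> (\<^bold>\<exists>n. W \<^bold>= f n))"

definition fLindelof :: "'a topology \<Rightarrow> 'p fml" where
  "fLindelof X =
    (\<^bold>\<forall>\<U> :: (('a, 'p) name, 'p) name. fOpen_cover X \<U> \<^bold>\<longrightarrow>
      (\<^bold>\<exists>\<V> :: (('a, 'p) name, 'p) name.
        (\<^bold>\<forall>W. W \<^bold>\<in>\<^bold>\<in> \<V> \<^bold>\<longrightarrow> W \<^bold>\<in>\<^bold>\<in> \<U>) \<^bold>\<and> fCountable \<V> \<^bold>\<and> fOpen_cover X \<V>))"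

text \<open>Something holds in every extension by \<open>r\<close> iff every condition of \<open>r\<close> forces it. As HOL
  cannot quantify over types inside a formula, the type \<open>'p\<close> of the conditions is a parameter.
  Destructibility with respect to any particular \<open>'p\<close> is destructibility by an actual countably
  closed forcing notion, hence implies destructibility in the unrestricted sense.\<close>

definition indestructible :: "'p itself \<Rightarrow> 'a topology \<Rightarrow> bool" where
  "indestructible (_ :: 'p itself) X \<longleftrightarrow>
    Lindelof_space X \<and>
    (\<forall>r :: 'p rel. forcing_notion r \<and> countably_closed r \<longrightarrow>
      (\<forall>p\<in>Field r. fLindelof X r p))"

definition destructible :: "'p itself \<Rightarrow> 'a topology \<Rightarrow> bool" where
  "destructible (P :: 'p itself) X \<longleftrightarrow> Lindelof_space X \<and> \<not> indestructible P X"

end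

theory Submission
  imports Defs "HOL-Library.Countable_Set_Type"
begin

text \<open>The space \<open>X\<close> consists of the paths (downward closed chains) of the tree of nonempty countable
  subsets of \<open>\<omega>\<^sub>1\<close> under end-extension, with the topology inherited from the Cantor cube over the
  tree; it is closed in the cube. Forcing with the tree adds a new path \<open>G\<close>, and the sets
  \<open>{P \<in> X. t \<notin> P}\<close> for \<open>t \<in> G\<close> form an open cover of the ground-model paths without a countable
  subcover.

  For the selection principle, compactness reduces each cover \<open>\<U> \<xi>\<close> to a finite set \<open>F \<xi>\<close> of nodes: the
  paths through \<open>s\<close> lie in a single member of \<open>\<U> \<xi>\<close> unless some \<open>f \<in> F \<xi>\<close> is strictly above \<open>s\<close>.
  Let \<open>D\<close> be the set of nodes \<open>s\<close> for which such an \<open>f\<close> exists for all but countably many \<open>\<xi>\<close>. An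
  infinite antichain in \<open>D\<close> would force some \<open>F \<xi>\<close> to be infinite, and hence \<open>D\<close> contains only
  finitely many uncountable paths. Under CH there are only \<open>\<omega>\<^sub>1\<close> many nodes and countable paths, so
  that one stage can be reserved for each countable path, each of the exceptional paths, and each
  node outside of \<open>D\<close>; every other path passes through such a node.\<close>

section \<open>Destroying the Lindelof property\<close>

text \<open>Implication abbreviates a negation, so its conclusion is reached only at some extension
  of \<open>q\<close>, not at \<open>q\<close> itself. This is why so many facts below hold only
  after strengthening a condition.\<close>

lemma fImp_iff:
  "(\<phi> \<^bold>\<longrightarrow> \<psi>) r p \<longleftrightarrow> (\<forall>q. (q, p) \<in> r \<longrightarrow> \<phi> r q \<longrightarrow> (\<exists>q'. (q', q) \<in> r \<and> \<psi> r q'))"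
  by (auto simp: fImp_def fNot_def fAnd_def)

lemma fEx_iff:
  "(\<^bold>\<exists>x. \<phi> x) r p \<longleftrightarrow> (\<forall>q. (q, p) \<in> r \<longrightarrow> (\<exists>q' x. (q', q) \<in> r \<and> \<phi> x r q'))"
  unfolding fEx_def fNot_def fAll_def by meson

lemmas forces_iff = fImp_iff fEx_iff fIff_def fAnd_def fAll_def fGround_def

text \<open>The canonical name of a ground-model set: each element is paired with all conditions, so
  the value is \<open>A\<close> under every generic filter.\<close>

definition check :: "'p rel \<Rightarrow> 'a set \<Rightarrow> ('a, 'p) name" where
  "check r A = A \<times> Field r"

locale forcing =
  fixes r :: "'p rel"
  assumes preorder: "Preorder r"
begin

lemma refl: "p \<in> Field r \<Longrightarrow> (p, p) \<in> r"
  using preorder by (auto simp: preorder_on_def refl_on_def)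

lemma trans: "(p, q) \<in> r \<Longrightarrow> (q, s) \<in> r \<Longrightarrow> (p, s) \<in> r"
  using preorder unfolding preorder_on_def by (meson transD)

lemma Field1: "(p, q) \<in> r \<Longrightarrow> p \<in> Field r"
  and Field2: "(p, q) \<in> r \<Longrightarrow> q \<in> Field r"
  by (auto intro: FieldI1 FieldI2)

lemma fIn_mono: "fIn E s N r p \<Longrightarrow> (q, p) \<in> r \<Longrightarrow> fIn E s N r q"
  unfolding fIn_def by (meson trans)

lemma fElem_mono: "(x \<^bold>\<in> W) r p \<Longrightarrow> (q, p) \<in> r \<Longrightarrow> (x \<^bold>\<in> W) r q"
  unfolding fElem_def by (rule fIn_mono)

lemma fMember_mono: "(W \<^bold>\<in>\<^bold>\<in> \<U>) r p \<Longrightarrow> (q, p) \<in> r \<Longrightarrow> (W \<^bold>\<in>\<^bold>\<in> \<U>) r q"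
  unfolding fMember_def by (rule fIn_mono)

lemma fElem_check: "p \<in> Field r \<Longrightarrow> (x \<^bold>\<in> check r A) r p \<longleftrightarrow> x \<in> A"
  unfolding fElem_def fIn_def check_def fGround_def
  by (auto dest: refl Field1)

lemma fEq_iff:
  "(V \<^bold>= W) r p \<longleftrightarrow> (\<forall>x q. (q, p) \<in> r \<longrightarrow>
     ((x \<^bold>\<in> V) r q \<longrightarrow> (\<exists>q'. (q', q) \<in> r \<and> (x \<^bold>\<in> W) r q')) \<and>
     ((x \<^bold>\<in> W) r q \<longrightarrow> (\<exists>q'. (q', q) \<in> r \<and> (x \<^bold>\<in> V) r q')))"
  unfolding fEq_def forces_iff by blast

lemma fEq_mono: "(V \<^bold>= W) r p \<Longrightarrow> (q, p) \<in> r \<Longrightarrow> (V \<^bold>= W) r q"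
  unfolding fEq_iff by (meson trans)

lemma fEq_refl: "(V \<^bold>= V) r p"
  unfolding fEq_iff using Field1 refl by blast

lemma fEq_sym: "(V \<^bold>= W) r p \<Longrightarrow> (W \<^bold>= V) r p"
  unfolding fEq_iff by blast

lemma fEq_trans: "(U \<^bold>= V) r p \<Longrightarrow> (V \<^bold>= W) r p \<Longrightarrow> (U \<^bold>= W) r p"
  unfolding fEq_iff by (meson trans)

lemma fEq_fElem:
  "(V \<^bold>= W) r p \<Longrightarrow> (x \<^bold>\<in> V) r p \<Longrightarrow> p \<in> Field r \<Longrightarrow> \<exists>q. (q, p) \<in> r \<and> (x \<^bold>\<in> W) r q"
  unfolding fEq_iff using refl by blast

text \<open>Membership in a canonical name does not depend on the condition, so the strengthening in
  \<open>fEq_fElem\<close> does no harm and the conclusion is a plain truth.\<close>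

lemma fEq_check_fElem:
  assumes "(W \<^bold>= check r A) r p" "(x \<^bold>\<in> W) r p" "p \<in> Field r"
  shows "x \<in> A"
  using fEq_fElem[OF assms] fElem_check Field1 by metis

lemma fEq_check_eq:
  assumes "(check r A \<^bold>= check r B) r p" "p \<in> Field r"
  shows "A = B"
proof (intro set_eqI iffI)
  show "x \<in> B" if "x \<in> A" for x
    by (rule fEq_check_fElem[OF assms(1) _ assms(2)]) (simp add: fElem_check assms(2) that)
  show "x \<in> A" if "x \<in> B" for x
    by (rule fEq_check_fElem[OF fEq_sym[OF assms(1)] _ assms(2)]) (simp add: fElem_check assms(2) that)
qed

text \<open>The family of ground-model open sets that witnesses openness is the singleton
  \<open>{A}\<close>, named by \<open>check r {A}\<close>.\<close>

lemma fOpenin_check: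
  assumes "openin X A" "(W \<^bold>= check r A) r p"
  shows "fOpenin X W r p"
proof -
  have B: "(B \<^bold>\<in> check r {A}) r q \<longleftrightarrow> B = A" if "q \<in> Field r" for B q
    using that by (simp add: fElem_check)
  have 1: "(\<^bold>\<forall>B. B \<^bold>\<in> check r {A} \<^bold>\<longrightarrow> fGround (openin X B)) r q" for q
    unfolding forces_iff using B assms(1) refl Field1 by metis
  have 2: "(\<^bold>\<exists>B. B \<^bold>\<in> check r {A} \<^bold>\<and> fGround (x \<in> B)) r q \<longleftrightarrow> x \<in> A" if "q \<in> Field r" for x q
    unfolding forces_iff using that refl Field1 B by metis
  have 3: "(\<^bold>\<forall>x. x \<^bold>\<in> W \<^bold>\<longleftrightarrow> (\<^bold>\<exists>B. B \<^bold>\<in> check r {A} \<^bold>\<and> fGround (x \<in> B))) r q"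
    if "(q, p) \<in> r" for q
  proof -
    have eq: "(W \<^bold>= check r A) r q" using assms(2) that by (rule fEq_mono)
    have "(x \<^bold>\<in> W \<^bold>\<longrightarrow> (\<^bold>\<exists>B. B \<^bold>\<in> check r {A} \<^bold>\<and> fGround (x \<in> B))) r q" for x
      unfolding fImp_iff using 2 fEq_check_fElem fEq_mono[OF eq] Field1 refl by meson
    moreover have "((\<^bold>\<exists>B. B \<^bold>\<in> check r {A} \<^bold>\<and> fGround (x \<in> B)) \<^bold>\<longrightarrow> x \<^bold>\<in> W) r q" for x
      unfolding fImp_iff using 2 fEq_fElem[OF fEq_sym[OF fEq_mono[OF eq]]] fElem_check Field1
      by meson
    ultimately show ?thesis unfolding fAll_def fIff_def fAnd_def by blast
  qed
  show ?thesis
    unfolding fOpenin_def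
  proof (rule fEx_iff[THEN iffD2], intro allI impI exI)
    fix q assume q: "(q, p) \<in> r"
    then show "(q, q) \<in> r \<and> ((\<^bold>\<forall>B. B \<^bold>\<in> check r {A} \<^bold>\<longrightarrow> fGround (openin X B)) \<^bold>\<and>
      (\<^bold>\<forall>x. x \<^bold>\<in> W \<^bold>\<longleftrightarrow> (\<^bold>\<exists>B. B \<^bold>\<in> check r {A} \<^bold>\<and> fGround (x \<in> B)))) r q"
      by (intro conjI fAnd_def[THEN iffD2] refl[OF Field1[OF q]] 1[of q] 3[OF q])
  qed
qed

section \<open>The open cover given by the generic filter\<close>

text \<open>In the extension, the cover consists of the sets \<open>A c\<close> for \<open>c\<close> in the generic filter. A
  countable subfamily lies in the ground model by countable closure, and a condition below all
  the conditions involved yields a point outside of it.\<close>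

definition generic_family :: "('p \<Rightarrow> 'a set) \<Rightarrow> (('a, 'p) name, 'p) name" where
  "generic_family A = (\<lambda>c. (check r (A c), c)) ` Field r"

text \<open>A condition below \<open>c\<close> forces \<open>c\<close> into the generic filter, and
  thereby \<open>A c\<close> into the family.\<close>

lemma fMember_generic_family:
  "(W \<^bold>\<in>\<^bold>\<in> generic_family A) r p \<longleftrightarrow>
    (\<forall>q. (q, p) \<in> r \<longrightarrow> (\<exists>q' c. (q', q) \<in> r \<and> (q', c) \<in> r \<and> (W \<^bold>= check r (A c)) r q'))"
  unfolding fMember_def fIn_def generic_family_def using Field2 by fastforce

lemma fOpen_cover_generic_family:
  assumes A: "\<And>c. c \<in> Field r \<Longrightarrow> openin X (A c)"
    and cover: "\<And>x p. x \<in> topspace X \<Longrightarrow> p \<in> Field r \<Longrightarrow> \<exists>q. (q, p) \<in> r \<and> x \<in> A q"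
  shows "fOpen_cover X (generic_family A) r p"
proof -
  have "fOpenin X W r q'" if "(W \<^bold>= check r (A c)) r q'" "(q', c) \<in> r" for W q' c
    using that fOpenin_check A Field2 by blast
  then have "(\<^bold>\<forall>W. W \<^bold>\<in>\<^bold>\<in> generic_family A \<^bold>\<longrightarrow> fOpenin X W) r p"
    unfolding fAll_def fImp_iff fMember_generic_family using refl Field1 by meson
  moreover have "(fGround (x \<in> topspace X) \<^bold>\<longrightarrow> (\<^bold>\<exists>W. W \<^bold>\<in>\<^bold>\<in> generic_family A \<^bold>\<and> x \<^bold>\<in> W)) r p" for x
  proof -
    have *: "\<exists>q' W. (q', q) \<in> r \<and> (W \<^bold>\<in>\<^bold>\<in> generic_family A) r q' \<and> (x \<^bold>\<in> W) r q'"
      if x: "x \<in> topspace X" and q: "q \<in> Field r" for q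
    proof -
      obtain q' where q': "(q', q) \<in> r" "x \<in> A q'" using cover[OF x q] by blast
      \<comment> \<open>The condition \<open>q'\<close> lies below itself, so it puts its own set
        \<open>A q'\<close> into the family.\<close>
      then have "(check r (A q') \<^bold>\<in>\<^bold>\<in> generic_family A) r q'"
        unfolding fMember_generic_family using refl Field1 fEq_refl by blast
      moreover have "(x \<^bold>\<in> check r (A q')) r q'"
        using q'(2) by (simp add: fElem_check[OF Field1[OF q'(1)]])
      ultimately show ?thesis using q'(1) by blast
    qed
    have "(\<^bold>\<exists>W. W \<^bold>\<in>\<^bold>\<in> generic_family A \<^bold>\<and> x \<^bold>\<in> W) r q" if "x \<in> topspace X" for q
      unfolding fEx_iff fAnd_def using *[OF that] Field1 by meson
    then show ?thesis unfolding fImp_iff fGround_def using refl Field1 by meson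
  qed
  moreover have "((\<^bold>\<exists>W. W \<^bold>\<in>\<^bold>\<in> generic_family A \<^bold>\<and> x \<^bold>\<in> W) \<^bold>\<longrightarrow> fGround (x \<in> topspace X)) r p" for x
    unfolding fImp_iff
  proof (intro allI impI)
    fix q assume q: "(q, p) \<in> r" and *: "(\<^bold>\<exists>W. W \<^bold>\<in>\<^bold>\<in> generic_family A \<^bold>\<and> x \<^bold>\<in> W) r q"
    obtain q' W where q': "(q', q) \<in> r" "(W \<^bold>\<in>\<^bold>\<in> generic_family A) r q'" "(x \<^bold>\<in> W) r q'"
      using * q refl Field1 unfolding fEx_iff fAnd_def by blast
    obtain u c where u: "(u, q') \<in> r" "(u, c) \<in> r" "(W \<^bold>= check r (A c)) r u"
      using q'(1,2) refl Field1 unfolding fMember_generic_family by blast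
    have "x \<in> A c" by (rule fEq_check_fElem[OF u(3) fElem_mono[OF q'(3) u(1)] Field1[OF u(1)]])
    then have "x \<in> topspace X" using A u(2) Field2 openin_subset by blast
    then show "\<exists>q'. (q', q) \<in> r \<and> fGround (x \<in> topspace X) r q'"
      using q' unfolding fGround_def by blast
  qed
  ultimately show ?thesis unfolding fOpen_cover_def fAnd_def fAll_def fIff_def by blast
qed

text \<open>\<open>cover\<close> is density: any condition can be strengthened so as to put a given
  ground-model point into a set of the family. \<open>miss\<close> says that no condition alone puts
  enough sets into the family to cover the space.\<close>

lemma not_fLindelof:
  assumes closed: "countably_closed r"
    and A: "\<And>c. c \<in> Field r \<Longrightarrow> openin X (A c)"
    and cover: "\<And>x p. x \<in> topspace X \<Longrightarrow> p \<in> Field r \<Longrightarrow> \<exists>q. (q, p) \<in> r \<and> x \<in> A q"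
    and miss: "\<And>p. p \<in> Field r \<Longrightarrow> \<exists>x\<in>topspace X. \<forall>c. (p, c) \<in> r \<longrightarrow> x \<notin> A c"
    and p: "p \<in> Field r"
  shows "\<not> fLindelof X r p"
proof
  let ?U = "generic_family A"
  assume "fLindelof X r p"
  moreover have "fOpen_cover X ?U r p"
    by (rule fOpen_cover_generic_family[OF A cover])
  ultimately obtain q0 where "q0 \<in> Field r"
    and "(\<^bold>\<exists>\<V>. (\<^bold>\<forall>W. W \<^bold>\<in>\<^bold>\<in> \<V> \<^bold>\<longrightarrow> W \<^bold>\<in>\<^bold>\<in> ?U) \<^bold>\<and> fCountable \<V> \<^bold>\<and> fOpen_cover X \<V>) r q0"
    unfolding fLindelof_def fAll_def fImp_iff using refl[OF p] Field1 by meson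
  then obtain q \<V> where q: "q \<in> Field r"
    and sub: "(\<^bold>\<forall>W. W \<^bold>\<in>\<^bold>\<in> \<V> \<^bold>\<longrightarrow> W \<^bold>\<in>\<^bold>\<in> ?U) r q"
    and cnt: "fCountable \<V> r q" and V: "fOpen_cover X \<V> r q"
    unfolding fEx_iff fAnd_def using refl Field1 by blast
  obtain q1 and f :: "nat \<Rightarrow> ('a, 'p) name" where q1: "(q1, q) \<in> r"
    and f: "(\<^bold>\<forall>W. W \<^bold>\<in>\<^bold>\<in> \<V> \<^bold>\<longrightarrow> (\<^bold>\<exists>n. W \<^bold>= f n)) r q1"
    using iffD1[OF fEx_iff cnt[unfolded fCountable_def]] refl[OF q] by blast
  \<comment> \<open>\<open>D n u\<close> means that \<open>u\<close> identifies \<open>f n\<close>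
    as a ground-model set \<open>A c\<close> whose index \<open>c\<close> it forces into the generic
    filter.\<close>
  define D where "D = (\<lambda>n u. \<exists>c. (u, c) \<in> r \<and> (f n \<^bold>= check r (A c)) r u)"
  \<comment> \<open>Any condition has an extension that decides \<open>f n\<close> in this sense, or
    below which no condition does.\<close>
  have "\<exists>u'. (u', u) \<in> r \<and> (D n u' \<or> (\<forall>v. (v, u') \<in> r \<longrightarrow> \<not> D n v))" if "u \<in> Field r" for n u
    using refl[OF that] by blast
  then have "\<forall>n u. \<exists>u'. u \<in> Field r \<longrightarrow> (u', u) \<in> r \<and> (D n u' \<or> (\<forall>v. (v, u') \<in> r \<longrightarrow> \<not> D n v))"
    by blast
  from this[unfolded choice_iff] obtain g where g: "\<And>n u. u \<in> Field r \<Longrightarrow>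
      (g n u, u) \<in> r \<and> (D n (g n u) \<or> (\<forall>v. (v, g n u) \<in> r \<longrightarrow> \<not> D n v))"
    by blast
  \<comment> \<open>The question for \<open>f n\<close> is settled at \<open>s (Suc n)\<close>,
    starting from \<open>s 0 = q1\<close>.\<close>
  define s where "s = rec_nat q1 g"
  have s: "s 0 = q1" "s (Suc n) = g n (s n)" for n
    by (simp_all add: s_def)
  have s_Field: "s n \<in> Field r" for n
  proof (induction n)
    case 0
    then show ?case using q1 Field1 s(1) by simp
  next
    case (Suc n)
    then show ?case using g[OF Suc] Field1 unfolding s(2) by blast
  qed
  have s_Suc: "(s (Suc n), s n) \<in> r" for n
    using g s s_Field by metis
  have s_mono: "(s j, s i) \<in> r" if "i \<le> j" for i j
    using that by (induction j rule: dec_induct) (use s_Suc s_Field refl trans in blast)+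
  have "\<forall>i j. (i, j) \<in> natLeq \<longrightarrow> (s j, s i) \<in> r"
    by (auto simp: natLeq_def s_mono)
  then have "\<exists>l\<in>Field r. \<forall>i\<in>Field natLeq. (l, s i) \<in> r"
    using closed[unfolded countably_closed_def, rule_format, of natLeq s] natLeq_Well_order s_Field
    by simp
  then obtain l where l: "l \<in> Field r" "\<And>n. (l, s n) \<in> r"
    unfolding Field_natLeq by blast
  \<comment> \<open>\<open>x\<close> avoids every \<open>A c\<close> with \<open>c\<close> above
    \<open>l\<close>, hence all the sets decided along \<open>s\<close>.\<close>
  obtain x where x: "x \<in> topspace X" "\<And>c. (l, c) \<in> r \<Longrightarrow> x \<notin> A c"
    using miss[OF l(1)] by blast
  have lq1: "(l, q1) \<in> r" using l(2)[of 0] s by simp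
  have lq: "(l, q) \<in> r" using lq1 q1 trans by blast
  \<comment> \<open>From here on conditions below \<open>l\<close> are strengthened until they
    provide a member \<open>W\<close> of \<open>\<V>\<close> containing \<open>x\<close>, a set
    \<open>A c\<close> equal to \<open>W\<close>, and an index \<open>n\<close> with
    \<open>W\<close> equal to \<open>f n\<close>.\<close>
  obtain v where v: "(v, l) \<in> r" "(\<^bold>\<exists>W. W \<^bold>\<in>\<^bold>\<in> \<V> \<^bold>\<and> x \<^bold>\<in> W) r v"
    using V x(1) lq unfolding fOpen_cover_def fAnd_def fAll_def fIff_def fImp_iff fGround_def by blast
  obtain v1 W where v1: "(v1, v) \<in> r" "(W \<^bold>\<in>\<^bold>\<in> \<V>) r v1" "(x \<^bold>\<in> W) r v1"
    using v refl Field1 unfolding fEx_iff fAnd_def by blast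
  have "(v1, q) \<in> r" using v1(1) v(1) lq trans by blast
  then obtain v2 where v2: "(v2, v1) \<in> r" "(W \<^bold>\<in>\<^bold>\<in> ?U) r v2"
    using sub v1(2) unfolding fAll_def fImp_iff by blast
  obtain v3 c where v3: "(v3, v2) \<in> r" "(v3, c) \<in> r" "(W \<^bold>= check r (A c)) r v3"
    using v2 refl Field1 unfolding fMember_generic_family by blast
  have v31: "(v3, v1) \<in> r" using v3(1) v2(1) trans by blast
  have v3l: "(v3, l) \<in> r" using v31 v1(1) v(1) trans by blast
  have "(W \<^bold>\<in>\<^bold>\<in> \<V>) r v3" using v1(2) v31 by (rule fMember_mono)
  moreover have "(v3, q1) \<in> r" using v3l lq1 trans by blast
  ultimately obtain v4' where v4': "(v4', v3) \<in> r" "(\<^bold>\<exists>n. W \<^bold>= f n) r v4'"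
    using f unfolding fAll_def fImp_iff by blast
  then obtain v4 n where v4: "(v4, v3) \<in> r" "(W \<^bold>= f n) r v4"
    unfolding fEx_iff using refl Field1 trans by metis
  have W4: "(W \<^bold>= check r (A c)) r v4" using v3(3) v4(1) by (rule fEq_mono)
  have "x \<in> A c"
    by (rule fEq_check_fElem[OF W4 fElem_mono[OF v1(3)]]) (use v4(1) v31 trans Field1 in blast)+
  have v4l: "(v4, l) \<in> r" using v4(1) v3l trans by blast
  have fn: "(f n \<^bold>= check r (A c)) r v4"
    using fEq_trans[OF fEq_sym[OF v4(2)] W4] .
  then have "D n v4" using v4(1) v3(2) trans unfolding D_def by blast
  moreover have v4s: "(v4, s (Suc n)) \<in> r" using v4l l(2) trans by blast
  \<comment> \<open>\<open>v4\<close> decides \<open>f n\<close> below \<open>s (Suc n)\<close>,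
    which rules out the negative alternative in the choice of \<open>g\<close>.\<close>
  ultimately have "D n (s (Suc n))" using g[OF s_Field] s by metis
  then obtain c' where c': "(s (Suc n), c') \<in> r" "(f n \<^bold>= check r (A c')) r (s (Suc n))"
    unfolding D_def by blast
  \<comment> \<open>\<open>f n\<close> is forced equal to two canonical names, so the two
    ground-model sets coincide; yet \<open>x\<close> lies in the first and not in the
    second.\<close>
  have "(check r (A c) \<^bold>= check r (A c')) r v4"
    using fEq_trans[OF fEq_sym[OF fn] fEq_mono[OF c'(2) v4s]] .
  then have "A c = A c'" using fEq_check_eq v4(1) Field1 by blast
  moreover have "x \<notin> A c'" using x(2) c'(1) l(2) trans by blast
  ultimately show False using \<open>x \<in> A c\<close> by simp
qed

end

section \<open>Path spaces of trees\<close>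

text \<open>The product topology on characteristic functions, described on the sets themselves: a
  basic neighbourhood fixes the trace on a finite set.\<close>

definition cantor_topology :: "'a set topology" where
  "cantor_topology = topology (\<lambda>U. \<forall>P\<in>U. \<exists>F. finite F \<and> (\<forall>Q. Q \<inter> F = P \<inter> F \<longrightarrow> Q \<in> U))"

lemma openin_cantor_topology:
  fixes U :: "'a set set"
  shows "openin cantor_topology U \<longleftrightarrow> (\<forall>P\<in>U. \<exists>F. finite F \<and> (\<forall>Q. Q \<inter> F = P \<inter> F \<longrightarrow> Q \<in> U))"
proof -
  have "istopology (\<lambda>U :: 'a set set. \<forall>P\<in>U. \<exists>F. finite F \<and> (\<forall>Q. Q \<inter> F = P \<inter> F \<longrightarrow> Q \<in> U))"
    unfolding istopology_def
  proof (intro conjI allI impI ballI)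
    fix S T :: "'a set set" and P
    assume S: "\<forall>P\<in>S. \<exists>F. finite F \<and> (\<forall>Q. Q \<inter> F = P \<inter> F \<longrightarrow> Q \<in> S)"
      and T: "\<forall>P\<in>T. \<exists>F. finite F \<and> (\<forall>Q. Q \<inter> F = P \<inter> F \<longrightarrow> Q \<in> T)"
      and P: "P \<in> S \<inter> T"
    obtain F where F: "finite F" "\<And>Q. Q \<inter> F = P \<inter> F \<Longrightarrow> Q \<in> S" using S P by blast
    obtain G where G: "finite G" "\<And>Q. Q \<inter> G = P \<inter> G \<Longrightarrow> Q \<in> T" using T P by blast
    have "Q \<in> S \<inter> T" if "Q \<inter> (F \<union> G) = P \<inter> (F \<union> G)" for Q
      using F(2)[of Q] G(2)[of Q] that by blast
    then show "\<exists>F. finite F \<and> (\<forall>Q. Q \<inter> F = P \<inter> F \<longrightarrow> Q \<in> S \<inter> T)"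
      using F(1) G(1) by (meson finite_UnI)
  next
    fix \<K> :: "'a set set set" and P
    assume K: "\<forall>K\<in>\<K>. \<forall>P\<in>K. \<exists>F. finite F \<and> (\<forall>Q. Q \<inter> F = P \<inter> F \<longrightarrow> Q \<in> K)" and "P \<in> \<Union>\<K>"
    then obtain K where "K \<in> \<K>" "P \<in> K" by blast
    then show "\<exists>F. finite F \<and> (\<forall>Q. Q \<inter> F = P \<inter> F \<longrightarrow> Q \<in> \<Union>\<K>)"
      using K by (meson UnionI)
  qed
  then show ?thesis
    unfolding cantor_topology_def by (simp add: topology_inverse')
qed

lemma topspace_cantor_topology [simp]: "topspace cantor_topology = UNIV"
  using openin_subset[of cantor_topology UNIV] openin_cantor_topology[of UNIV] by auto

lemma openin_cantor_topology_restriction: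
  assumes "finite F"
  shows "openin cantor_topology {P. \<phi> (P \<inter> F)}"
  unfolding openin_cantor_topology using assms by (intro ballI exI[of _ F]) auto

lemma openin_cantor_topology_mem: "openin cantor_topology {P. t \<in> P}"
  using openin_cantor_topology_restriction[of "{t}" "\<lambda>Q. t \<in> Q"] by simp

lemma openin_cantor_topology_not_mem: "openin cantor_topology {P. t \<notin> P}"
  using openin_cantor_topology_restriction[of "{t}" "\<lambda>Q. t \<notin> Q"] by simp

lemma Hausdorff_space_cantor_topology: "Hausdorff_space (cantor_topology :: 'a set topology)"
  unfolding Hausdorff_space_def
proof (intro allI impI)
  fix P Q :: "'a set"
  assume "P \<in> topspace cantor_topology \<and> Q \<in> topspace cantor_topology \<and> P \<noteq> Q"
  then obtain t where "t \<in> P \<and> t \<notin> Q \<or> t \<notin> P \<and> t \<in> Q" by blast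
  then show "\<exists>U V. openin cantor_topology U \<and> openin cantor_topology V \<and>
      P \<in> U \<and> Q \<in> V \<and> disjnt U V"
  proof
    assume "t \<in> P \<and> t \<notin> Q"
    then show ?thesis
      using openin_cantor_topology_mem[of t] openin_cantor_topology_not_mem[of t]
      by (intro exI[of _ "{P. t \<in> P}"] exI[of _ "{P. t \<notin> P}"]) (auto simp: disjnt_def)
  next
    assume "t \<notin> P \<and> t \<in> Q"
    then show ?thesis
      using openin_cantor_topology_mem[of t] openin_cantor_topology_not_mem[of t]
      by (intro exI[of _ "{P. t \<notin> P}"] exI[of _ "{P. t \<in> P}"]) (auto simp: disjnt_def)
  qed
qed

text \<open>Tychonoff's theorem for functions into \<open>bool\<close>, transferred along
  \<open>Collect\<close>, which is continuous and onto.\<close>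

lemma compact_space_cantor_topology: "compact_space (cantor_topology :: 'a set topology)"
proof -
  let ?X = "product_topology (\<lambda>_. discrete_topology UNIV) UNIV :: ('a \<Rightarrow> bool) topology"
  have "openin ?X {f. Collect f \<in> U}" if U: "openin cantor_topology U" for U
    unfolding openin_product_topology_alt
  proof
    fix f assume f: "f \<in> {f. Collect f \<in> U}"
    then obtain F where F: "finite F" "\<And>Q. Q \<inter> F = Collect f \<inter> F \<Longrightarrow> Q \<in> U"
      using U unfolding openin_cantor_topology by blast
    define B where "B = (\<lambda>i. if i \<in> F then {f i} else UNIV)"
    have "finite {i. B i \<noteq> UNIV}"
      by (rule finite_subset[OF _ F(1)]) (auto simp: B_def)
    moreover have "f \<in> Pi\<^sub>E UNIV B" by (auto simp: B_def)
    moreover have "g \<in> {f. Collect f \<in> U}" if "g \<in> Pi\<^sub>E UNIV B" for g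
    proof -
      have "g i \<in> B i" for i using that by auto
      then have "Collect g \<inter> F = Collect f \<inter> F"
        unfolding B_def by (auto split: if_splits) (metis singletonD)+
      then show ?thesis using F(2) by simp
    qed
    ultimately show "\<exists>B. finite {i \<in> UNIV. B i \<noteq> topspace (discrete_topology (UNIV :: bool set))} \<and>
        (\<forall>i\<in>UNIV. openin (discrete_topology UNIV) (B i)) \<and> f \<in> Pi\<^sub>E UNIV B \<and>
        Pi\<^sub>E UNIV B \<subseteq> {f. Collect f \<in> U}"
      by (intro exI[of _ B]) auto
  qed
  then have "continuous_map ?X cantor_topology Collect"
    by (simp add: continuous_map_def)
  moreover have "compact_space ?X"
    by (simp add: compact_space_product_topology compact_space_discrete_topology)
  then have "compactin ?X UNIV"
    by (simp add: compact_space_def)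
  ultimately have "compactin cantor_topology (range Collect :: 'a set set)"
    by (rule image_compactin[rotated])
  moreover have "range Collect = (UNIV :: 'a set set)"
    by (rule surjI) (rule Collect_mem_eq)
  ultimately show ?thesis by (simp add: compact_space_def)
qed

section \<open>Trees and compactness of their path spaces\<close>

text \<open>The order is constrained on \<open>T\<close> only, so that it can later be pulled back
  along a decoding that is arbitrary outside the coded nodes.\<close>

locale tree =
  fixes T :: "'a set" and le :: "'a \<Rightarrow> 'a \<Rightarrow> bool"  (infix "\<sqsubseteq>" 50)
  assumes le_refl: "t \<in> T \<Longrightarrow> t \<sqsubseteq> t"
    and le_trans: "s \<in> T \<Longrightarrow> t \<in> T \<Longrightarrow> u \<in> T \<Longrightarrow> s \<sqsubseteq> t \<Longrightarrow> t \<sqsubseteq> u \<Longrightarrow> s \<sqsubseteq> u"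
    and le_linear: "s \<in> T \<Longrightarrow> t \<in> T \<Longrightarrow> u \<in> T \<Longrightarrow> s \<sqsubseteq> u \<Longrightarrow> t \<sqsubseteq> u \<Longrightarrow> s \<sqsubseteq> t \<or> t \<sqsubseteq> s"
    and countable_predecessors: "t \<in> T \<Longrightarrow> countable {s \<in> T. s \<sqsubseteq> t}"
begin

definition paths :: "'a set set" where
  "paths = {P. P \<subseteq> T \<and> (\<forall>s\<in>P. \<forall>t\<in>P. s \<sqsubseteq> t \<or> t \<sqsubseteq> s) \<and> (\<forall>t\<in>P. \<forall>s\<in>T. s \<sqsubseteq> t \<longrightarrow> s \<in> P)}"

definition path_space :: "'a set topology" where
  "path_space = subtopology cantor_topology paths"

lemma topspace_path_space [simp]: "topspace path_space = paths"
  by (simp add: path_space_def)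

text \<open>The path ending at \<open>t\<close> represents all paths through \<open>t\<close> in the
  selection argument, and is the point left uncovered in the forcing argument.\<close>

lemma predecessors_path:
  assumes t: "t \<in> T"
  shows "{s \<in> T. s \<sqsubseteq> t} \<in> paths"
proof -
  have "s \<sqsubseteq> u \<or> u \<sqsubseteq> s" if "s \<in> T" "s \<sqsubseteq> t" "u \<in> T" "u \<sqsubseteq> t" for s u
    using le_linear[OF that(1,3) t that(2,4)] .
  moreover have "s \<sqsubseteq> t" if "u \<in> T" "u \<sqsubseteq> t" "s \<in> T" "s \<sqsubseteq> u" for s u
    using le_trans[OF that(3,1) t that(4,2)] .
  ultimately show ?thesis unfolding paths_def by auto
qed

lemma Hausdorff_space_path_space: "Hausdorff_space path_space"
  unfolding path_space_def by (rule Hausdorff_space_subtopology[OF Hausdorff_space_cantor_topology])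

text \<open>Each way of failing to be a path is witnessed by at most two nodes, so the paths form a
  closed subset of the cube.\<close>

lemma compact_space_path_space: "compact_space path_space"
proof -
  have "openin cantor_topology (- paths)"
    unfolding openin_cantor_topology
  proof
    fix P assume P: "P \<in> - paths"
    consider t where "t \<in> P" "t \<notin> T"
      | s t where "s \<in> P" "t \<in> P" "\<not> s \<sqsubseteq> t" "\<not> t \<sqsubseteq> s"
      | s t where "t \<in> P" "s \<in> T" "s \<sqsubseteq> t" "s \<notin> P"
      using P unfolding paths_def by blast
    then obtain s t where "\<forall>Q. Q \<inter> {s, t} = P \<inter> {s, t} \<longrightarrow> Q \<in> - paths"
    proof cases
      case (1 t)
      then have "\<forall>Q. Q \<inter> {t, t} = P \<inter> {t, t} \<longrightarrow> Q \<in> - paths"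
        unfolding paths_def by blast
      then show ?thesis by (rule that)
    next
      case (2 s t)
      then have "\<forall>Q. Q \<inter> {s, t} = P \<inter> {s, t} \<longrightarrow> Q \<in> - paths"
        unfolding paths_def by blast
      then show ?thesis by (rule that)
    next
      case (3 s t)
      then have "\<forall>Q. Q \<inter> {s, t} = P \<inter> {s, t} \<longrightarrow> Q \<in> - paths"
        unfolding paths_def by blast
      then show ?thesis by (rule that)
    qed
    then show "\<exists>F. finite F \<and> (\<forall>Q. Q \<inter> F = P \<inter> F \<longrightarrow> Q \<in> - paths)"
      by (meson finite.emptyI finite.insertI)
  qed
  then have "closedin cantor_topology paths"
    by (simp add: closedin_def Compl_eq_Diff_UNIV)
  then show ?thesis
    unfolding path_space_def
    using closedin_compact_space compact_space_cantor_topology compact_space_subtopology by blast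
qed

lemma openin_path_space_avoiding: "openin path_space {P \<in> paths. t \<notin> P}"
proof -
  have "{P \<in> paths. t \<notin> P} = {P. t \<notin> P} \<inter> paths" by blast
  then show ?thesis
    unfolding path_space_def openin_subtopology using openin_cantor_topology_not_mem[of t] by metis
qed

text \<open>Every path has a basic neighbourhood inside a member of the cover. By compactness
  finitely many of these suffice, and \<open>F\<close> is the union of their finite
  supports.\<close>

lemma finite_refinement:
  assumes "open_cover path_space \<U>"
  shows "\<exists>F. finite F \<and> (\<forall>P\<in>paths. \<exists>U\<in>\<U>. \<forall>Q\<in>paths. Q \<inter> F = P \<inter> F \<longrightarrow> Q \<in> U)"
proof -
  have op: "\<And>U. U \<in> \<U> \<Longrightarrow> openin path_space U" and un: "\<Union>\<U> = paths"
    using assms unfolding open_cover_def by auto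
  have "\<exists>U F. U \<in> \<U> \<and> finite F \<and> (\<forall>Q\<in>paths. Q \<inter> F = P \<inter> F \<longrightarrow> Q \<in> U)" if P: "P \<in> paths" for P
  proof -
    obtain U where U: "U \<in> \<U>" "P \<in> U" using P un by blast
    obtain V where V: "openin cantor_topology V" "U = V \<inter> paths"
      using op[OF U(1)] unfolding path_space_def openin_subtopology by blast
    then obtain F where "finite F" "\<forall>Q. Q \<inter> F = P \<inter> F \<longrightarrow> Q \<in> V"
      using U(2) unfolding openin_cantor_topology by blast
    then show ?thesis using U(1) V(2) by blast
  qed
  then obtain U F where UF: "\<And>P. P \<in> paths \<Longrightarrow> U P \<in> \<U>" "\<And>P. P \<in> paths \<Longrightarrow> finite (F P)"
      "\<And>P Q. P \<in> paths \<Longrightarrow> Q \<in> paths \<Longrightarrow> Q \<inter> F P = P \<inter> F P \<Longrightarrow> Q \<in> U P"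
    by metis
  define B where "B = (\<lambda>P. {Q \<in> paths. Q \<inter> F P = P \<inter> F P})"
  have "openin path_space (B P)" if "P \<in> paths" for P
  proof -
    have "B P = {Q. Q \<inter> F P = P \<inter> F P} \<inter> paths" by (auto simp: B_def)
    then show ?thesis
      using openin_cantor_topology_restriction[OF UF(2)[OF that], of "\<lambda>Q. Q = P \<inter> F P"]
      unfolding path_space_def openin_subtopology by blast
  qed
  moreover have "paths \<subseteq> \<Union>(B ` paths)" by (auto simp: B_def)
  ultimately obtain \<F> where "finite \<F>" "\<F> \<subseteq> B ` paths" "paths \<subseteq> \<Union>\<F>"
    using compact_space_path_space[unfolded compact_space_alt, rule_format, of "B ` paths"] by auto
  then obtain \<P> where \<P>: "\<P> \<subseteq> paths" "finite \<P>" "paths \<subseteq> \<Union>(B ` \<P>)"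
    by (metis finite_subset_image)
  have "\<exists>U\<in>\<U>. \<forall>Q\<in>paths. Q \<inter> \<Union>(F ` \<P>) = P \<inter> \<Union>(F ` \<P>) \<longrightarrow> Q \<in> U" if P: "P \<in> paths" for P
  proof -
    obtain R where R: "R \<in> \<P>" "P \<inter> F R = R \<inter> F R" using P \<P>(3) unfolding B_def by blast
    have "Q \<in> U R" if "Q \<in> paths" "Q \<inter> \<Union>(F ` \<P>) = P \<inter> \<Union>(F ` \<P>)" for Q
    proof -
      have "Q \<inter> F R = P \<inter> F R" using that(2) R(1) by blast
      then show ?thesis using UF(3) R \<P>(1) that(1) by auto
    qed
    then show ?thesis using UF(1) R(1) \<P>(1) by blast
  qed
  moreover have "finite (\<Union>(F ` \<P>))" using \<P> UF(2) by blast
  ultimately show ?thesis by blast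
qed

end

section \<open>Selecting from aleph one many covers\<close>

unbundle cardinal_syntax

section \<open>Aleph one and injective choice from uncountable sets\<close>

lemma Card_order_omega1: "Card_order (cardSuc natLeq)"
  by (rule cardSuc_Card_order[OF natLeq_Card_order])

lemma Well_order_omega1: "Well_order (cardSuc natLeq)"
  using Card_order_omega1 card_order_on_well_order_on by blast

lemma card_of_omega1: "|omega1| =o cardSuc natLeq"
  unfolding omega1_def by (rule card_of_Field_ordIso[OF Card_order_omega1])

lemma uncountable_omega1: "uncountable omega1"
proof
  assume "countable omega1"
  then have "|omega1| \<le>o natLeq" by (simp add: countable_card_le_natLeq)
  then have "cardSuc natLeq \<le>o natLeq"
    using card_of_omega1 ordIso_symmetric ordIso_ordLeq_trans by blast
  then show False
    using cardSuc_greater[OF natLeq_Card_order] not_ordLess_ordLeq by blast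
qed

lemma countable_underS_omega1: "countable (underS (cardSuc natLeq) a)"
proof (cases "a \<in> Field (cardSuc natLeq)")
  case True
  then have "|underS (cardSuc natLeq) a| <o cardSuc natLeq"
    by (rule card_of_underS[OF Card_order_omega1])
  then show ?thesis
    by (simp add: countable_card_le_natLeq cardSuc_ordLeq_ordLess[OF natLeq_Card_order card_of_Card_order])
next
  case False
  then have "underS (cardSuc natLeq) a = {}" by (auto simp: underS_def Field_def)
  then show ?thesis by simp
qed

lemma countable_imp_ordLeq_omega1: "countable A \<Longrightarrow> |A| \<le>o cardSuc natLeq"
  using ordLeq_transitive[OF _ cardSuc_ordLeq[OF natLeq_Card_order]]
  by (simp add: countable_card_le_natLeq)

lemma Un_ordLeq_omega1:
  assumes "|A| \<le>o cardSuc natLeq" "|B| \<le>o cardSuc natLeq"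
  shows "|A \<union> B| \<le>o cardSuc natLeq"
proof (rule card_of_Un_ordLeq_infinite_Field[OF _ assms Card_order_omega1])
  show "infinite (Field (cardSuc natLeq))"
    using uncountable_omega1 uncountable_infinite unfolding omega1_def by blast
qed

lemma uncountable_Diff_nonempty: "uncountable A \<Longrightarrow> countable B \<Longrightarrow> A - B \<noteq> {}"
  using countable_subset by auto

text \<open>Recursion along a well-order in which every stage has countably many predecessors: the
  values used so far cannot exhaust the uncountable set \<open>N i\<close>.\<close>

lemma inj_choice_omega1:
  assumes I: "|I| \<le>o cardSuc natLeq" and N: "\<And>i. i \<in> I \<Longrightarrow> uncountable (N i)"
  shows "\<exists>g. inj_on g I \<and> (\<forall>i\<in>I. g i \<in> N i)"
proof -
  let ?W = "cardSuc natLeq"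
  have "|I| \<le>o |omega1|"
    using I card_of_omega1 ordIso_symmetric ordLeq_ordIso_trans by blast
  then obtain h where h: "inj_on h I" "h ` I \<subseteq> omega1"
    unfolding card_of_ordLeq[symmetric] by blast
  \<comment> \<open>\<open>R\<close> is the strict order of \<open>omega1\<close> pulled back along
    the injection \<open>h\<close>; its initial segments within \<open>I\<close> are
    countable.\<close>
  define R where "R = inv_image (?W - Id) h"
  have "wf R"
    unfolding R_def using Well_order_omega1 by (intro wf_inv_image) (simp add: well_order_on_def)
  \<comment> \<open>The premise \<open>i \<in> I\<close> makes every value admissible outside
    \<open>I\<close>, so that the recursion runs on the whole type.\<close>
  moreover define P where "P = (\<lambda>f i y. i \<in> I \<longrightarrow> y \<in> N i \<and> y \<notin> f ` {j \<in> I. (j, i) \<in> R})"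
  moreover have "P f i y = P f' i y" if "\<And>z. (z, i) \<in> R \<Longrightarrow> f z = f' z" for f f' i y
  proof -
    have "f ` {j \<in> I. (j, i) \<in> R} = f' ` {j \<in> I. (j, i) \<in> R}" using that by (intro image_cong) auto
    then show ?thesis by (simp add: P_def)
  qed
  moreover have "\<exists>y. P f i y" for f i
  proof (cases "i \<in> I")
    case True
    have "h ` {j \<in> I. (j, i) \<in> R} \<subseteq> underS ?W (h i)"
      by (auto simp: R_def underS_def)
    then have "countable (h ` {j \<in> I. (j, i) \<in> R})"
      using countable_underS_omega1 countable_subset by blast
    then have "countable {j \<in> I. (j, i) \<in> R}"
      by (rule countable_image_inj_on) (rule inj_on_subset[OF h(1)], blast)
    then have "N i - f ` {j \<in> I. (j, i) \<in> R} \<noteq> {}"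
      by (intro uncountable_Diff_nonempty[OF N[OF True]] countable_image)
    then show ?thesis unfolding P_def by blast
  qed (simp add: P_def)
  ultimately obtain g where g: "\<And>i. P g i (g i)"
    using dependent_wf_choice[of R P] by presburger
  have lt: "g i \<noteq> g j" if "i \<in> I" "j \<in> I" "(j, i) \<in> R" for i j
  proof -
    have "g i \<notin> g ` {j \<in> I. (j, i) \<in> R}" using g[of i] that(1) unfolding P_def by blast
    then show ?thesis using that(2,3) by blast
  qed
  have "inj_on g I"
  proof (rule inj_onI, rule ccontr)
    fix i j assume ij: "i \<in> I" "j \<in> I" "g i = g j" "i \<noteq> j"
    then have "h i \<noteq> h j" using h(1) by (meson inj_onD)
    moreover have "h i \<in> Field ?W" "h j \<in> Field ?W" using h(2) ij unfolding omega1_def by blast+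
    ultimately have "(h i, h j) \<in> ?W \<or> (h j, h i) \<in> ?W"
      using Well_order_omega1 unfolding well_order_on_def linear_order_on_def total_on_def by blast
    then have "(i, j) \<in> R \<or> (j, i) \<in> R" using \<open>h i \<noteq> h j\<close> by (auto simp: R_def)
    then show False using lt[of i j] lt[of j i] ij by auto
  qed
  then show ?thesis using g unfolding P_def by blast
qed

context tree
begin

section \<open>Cones, antichains and the selection principle\<close>

lemma path_linear: "P \<in> paths \<Longrightarrow> s \<in> P \<Longrightarrow> t \<in> P \<Longrightarrow> s \<sqsubseteq> t \<or> t \<sqsubseteq> s"
  and path_closed: "P \<in> paths \<Longrightarrow> t \<in> P \<Longrightarrow> s \<in> T \<Longrightarrow> s \<sqsubseteq> t \<Longrightarrow> s \<in> P"
  and path_subset: "P \<in> paths \<Longrightarrow> s \<in> P \<Longrightarrow> s \<in> T"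
  unfolding paths_def by simp_all (simp add: subset_iff)

definition cone :: "'a \<Rightarrow> 'a set set" where
  "cone s = {P \<in> paths. s \<in> P}"

text \<open>All nodes of \<open>P\<close> are comparable with \<open>s\<close>. As no node of
  \<open>F\<close> is strictly above \<open>s\<close>, the set \<open>F\<close> cannot tell
  \<open>P\<close> from the path ending at \<open>s\<close>.\<close>

lemma cone_determined:
  assumes P: "P \<in> cone s" and s: "s \<in> T"
    and F: "\<And>f. f \<in> F \<Longrightarrow> f \<in> T \<Longrightarrow> s \<sqsubseteq> f \<Longrightarrow> f \<sqsubseteq> s"
  shows "P \<inter> F = {t \<in> T. t \<sqsubseteq> s} \<inter> F"
proof -
  have P': "P \<in> paths" "s \<in> P" using P by (auto simp: cone_def)
  have "f \<in> T \<and> f \<sqsubseteq> s" if "f \<in> P" "f \<in> F" for f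
    using path_linear[OF P'(1) that(1) P'(2)] F[OF that(2)] path_subset[OF P'(1) that(1)] by blast
  moreover have "f \<in> P" if "f \<in> T" "f \<sqsubseteq> s" for f
    using path_closed[OF P' that] .
  ultimately show ?thesis by auto
qed

text \<open>If \<open>P\<close> were properly contained in \<open>Q\<close>, a node of
  \<open>Q\<close> outside \<open>P\<close> would lie above all of \<open>P\<close>, and its
  predecessors are countable.\<close>

lemma uncountable_paths_diff:
  assumes "P \<in> paths" "Q \<in> paths" "uncountable P" "P \<noteq> Q"
  shows "\<exists>s\<in>P. s \<notin> Q"
proof (rule ccontr)
  assume "\<not> ?thesis"
  then obtain t where t: "t \<in> Q" "t \<notin> P" "P \<subseteq> Q" using assms(4) by blast
  have tT: "t \<in> T" using path_subset assms(2) t(1) .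
  have "s \<in> T \<and> s \<sqsubseteq> t" if "s \<in> P" for s
    using path_linear[OF assms(2) _ t(1)] path_closed[OF assms(1) that tT] path_subset[OF assms(1) that]
      that t by blast
  then have "P \<subseteq> {s \<in> T. s \<sqsubseteq> t}" by blast
  then show False using assms(3) countable_predecessors[OF tT] countable_subset by blast
qed

text \<open>High enough on each path of a countable subfamily there is a node lying on none of the
  others. Such nodes are incomparable, because paths are downward closed.\<close>

lemma infinite_antichain:
  assumes "infinite \<P>" and P: "\<And>P. P \<in> \<P> \<Longrightarrow> P \<in> paths" "\<And>P. P \<in> \<P> \<Longrightarrow> uncountable P"
  shows "\<exists>A. infinite A \<and> A \<subseteq> \<Union>\<P> \<and> (\<forall>s\<in>A. \<forall>t\<in>A. s \<sqsubseteq> t \<longrightarrow> s = t)"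
proof -
  obtain \<Q> where Q: "\<Q> \<subseteq> \<P>" "countable \<Q>" "infinite \<Q>"
    using infinite_countable_subset'[OF assms(1)] by blast
  have "\<exists>m\<in>P. \<forall>Q\<in>\<Q> - {P}. m \<notin> Q" if PQ: "P \<in> \<Q>" for P
  proof -
    have P1: "P \<in> paths" "uncountable P" using P Q(1) PQ by blast+
    have "\<exists>s. s \<in> P \<and> s \<notin> Q" if "Q \<in> \<Q> - {P}" for Q
    proof -
      have "Q \<in> paths" "P \<noteq> Q" using P(1)[of Q] Q(1) that by auto
      then show ?thesis using uncountable_paths_diff[OF P1(1) _ P1(2)] by metis
    qed
    then obtain c where c: "\<And>Q. Q \<in> \<Q> - {P} \<Longrightarrow> c Q \<in> P \<and> c Q \<notin> Q" by metis
    \<comment> \<open>\<open>c Q\<close> is a node of \<open>P\<close> off \<open>Q\<close>. A node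
      of \<open>P\<close> outside \<open>C\<close> lies above all of these, so no \<open>Q\<close>
      can contain it; countability of \<open>\<Q>\<close> keeps \<open>C\<close> countable.\<close>
    define C where "C = (\<Union>Q\<in>\<Q> - {P}. {s \<in> T. s \<sqsubseteq> c Q})"
    have "countable C"
      unfolding C_def
      by (intro countable_UN countable_predecessors path_subset[OF P1(1)]) (use Q(2) c in auto)
    then have "P - C \<noteq> {}"
      by (rule uncountable_Diff_nonempty[OF P1(2)])
    then obtain m where m: "m \<in> P" "m \<notin> C" by blast
    have "m \<notin> Q" if "Q \<in> \<Q> - {P}" for Q
    proof
      assume mQ: "m \<in> Q"
      have "c Q \<in> P" "c Q \<notin> Q" using c[OF that] by auto
      have "\<not> m \<sqsubseteq> c Q" using m path_subset[OF P1(1) m(1)] that unfolding C_def by blast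
      then have "c Q \<sqsubseteq> m" using path_linear[OF P1(1) m(1) \<open>c Q \<in> P\<close>] by blast
      then have "c Q \<in> Q"
        using path_closed[OF _ mQ path_subset[OF P1(1) \<open>c Q \<in> P\<close>]] P(1)[of Q] Q(1) that by auto
      then show False using \<open>c Q \<notin> Q\<close> by simp
    qed
    then show ?thesis using m(1) by blast
  qed
  then obtain m where m: "\<And>P. P \<in> \<Q> \<Longrightarrow> m P \<in> P" "\<And>P Q. P \<in> \<Q> \<Longrightarrow> Q \<in> \<Q> \<Longrightarrow> Q \<noteq> P \<Longrightarrow> m P \<notin> Q"
    by (metis DiffI singletonD)
  have "inj_on m \<Q>"
    by (rule inj_onI, rule ccontr) (use m in metis)
  then have "infinite (m ` \<Q>)" using Q(3) finite_imageD by blast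
  moreover have "m ` \<Q> \<subseteq> \<Union>\<P>" using m(1) Q(1) by blast
  moreover have "m P = m Q" if "P \<in> \<Q>" "Q \<in> \<Q>" "m P \<sqsubseteq> m Q" for P Q
  proof (rule ccontr)
    assume "m P \<noteq> m Q"
    then have "P \<noteq> Q" by blast
    have Qp: "Q \<in> paths" and Pp: "P \<in> paths" using that(1,2) Q(1) P(1) by blast+
    have "m P \<in> Q"
      using path_closed[OF Qp m(1)[OF that(2)] path_subset[OF Pp m(1)[OF that(1)]] that(3)] .
    then show False using m(2)[OF that(1,2)] \<open>P \<noteq> Q\<close> by blast
  qed
  ultimately show ?thesis by (intro exI[of _ "m ` \<Q>"]) auto
qed

text \<open>Nonempty countable sets of nodes are ranges of sequences, so \<open>card\<close> bounds
  the number of nodes as well as that of countable paths.\<close>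

lemma S1_omega1_path_space:
  assumes card: "|UNIV :: (nat \<Rightarrow> 'a) set| \<le>o cardSuc natLeq"
  shows "S1_omega1 path_space"
  unfolding S1_omega1_def topspace_path_space
proof (intro allI impI)
  fix \<U> :: "nat set \<Rightarrow> 'a set set set"
  assume cov: "\<forall>\<xi>\<in>omega1. open_cover path_space (\<U> \<xi>)"
  have un: "\<Union>(\<U> \<xi>) = paths" if "\<xi> \<in> omega1" for \<xi>
    using cov that unfolding open_cover_def by simp
  have "\<forall>\<xi>\<in>omega1. \<exists>F. finite F \<and> (\<forall>P\<in>paths. \<exists>U\<in>\<U> \<xi>. \<forall>Q\<in>paths. Q \<inter> F = P \<inter> F \<longrightarrow> Q \<in> U)"
    using cov finite_refinement by blast
  then obtain F where F: "\<And>\<xi>. \<xi> \<in> omega1 \<Longrightarrow> finite (F \<xi>)"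
      "\<And>\<xi> P. \<xi> \<in> omega1 \<Longrightarrow> P \<in> paths \<Longrightarrow> \<exists>U\<in>\<U> \<xi>. \<forall>Q\<in>paths. Q \<inter> F \<xi> = P \<inter> F \<xi> \<longrightarrow> Q \<in> U"
    by metis
  \<comment> \<open>The stages that may be reserved for \<open>K\<close>.\<close>
  define N where "N = (\<lambda>K. {\<xi>\<in>omega1. \<exists>U\<in>\<U> \<xi>. K \<subseteq> U})"
  \<comment> \<open>At the stages outside \<open>above s\<close>, all paths through \<open>s\<close>
    have the same trace on \<open>F \<xi>\<close>, by \<open>cone_determined\<close>.\<close>
  define above where "above = (\<lambda>s. {\<xi>\<in>omega1. \<exists>f\<in>F \<xi>. f \<in> T \<and> s \<sqsubseteq> f \<and> \<not> f \<sqsubseteq> s})"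
  define D where "D = {s \<in> T. countable (omega1 - above s)}"
  define \<P> where "\<P> = {P \<in> paths. uncountable P \<and> P \<subseteq> D}"
  have N_cone: "uncountable (N (cone s))" if "s \<in> T - D" for s
  proof -
    have s: "s \<in> T" using that by simp
    have "\<xi> \<in> N (cone s)" if \<xi>: "\<xi> \<in> omega1 - above s" for \<xi>
    proof -
      have \<xi>1: "\<xi> \<in> omega1" using \<xi> by simp
      \<comment> \<open>The member chosen for the path ending at \<open>s\<close> contains the whole
        cone.\<close>
      obtain U where U: "U \<in> \<U> \<xi>" "\<And>Q. Q \<in> paths \<Longrightarrow> Q \<inter> F \<xi> = {t \<in> T. t \<sqsubseteq> s} \<inter> F \<xi> \<Longrightarrow> Q \<in> U"
        using F(2)[OF \<xi>1 predecessors_path[OF s]] by blast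
      have "f \<sqsubseteq> s" if "f \<in> F \<xi>" "f \<in> T" "s \<sqsubseteq> f" for f
        using \<xi> that unfolding above_def by blast
      then have "Q \<in> U" if "Q \<in> cone s" for Q
        using U(2) cone_determined[OF that s] that by (simp add: cone_def)
      then show ?thesis using \<xi>1 U(1) unfolding N_def by blast
    qed
    then have "omega1 - above s \<subseteq> N (cone s)" by blast
    moreover have "uncountable (omega1 - above s)" using that by (simp add: D_def)
    ultimately show ?thesis using countable_subset by blast
  qed
  have N_point: "uncountable (N {P})" if P: "P \<in> paths" for P
  proof -
    have "N {P} = omega1" using P un unfolding N_def by auto
    then show ?thesis using uncountable_omega1 by simp
  qed
  have "finite \<P>"
  proof (rule ccontr)
    assume inf: "infinite \<P>"
    have "\<exists>A. infinite A \<and> A \<subseteq> \<Union>\<P> \<and> (\<forall>s\<in>A. \<forall>t\<in>A. s \<sqsubseteq> t \<longrightarrow> s = t)"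
      by (rule infinite_antichain[OF inf]) (simp_all add: \<P>_def)
    then obtain A where "infinite A" "A \<subseteq> \<Union>\<P>" and anti: "\<forall>s\<in>A. \<forall>t\<in>A. s \<sqsubseteq> t \<longrightarrow> s = t"
      by (elim exE conjE) (rule that)
    then obtain B where B: "countable B" "infinite B" "B \<subseteq> A"
      using infinite_countable_subset'[OF \<open>infinite A\<close>] by blast
    have BD: "B \<subseteq> D" using B(3) \<open>A \<subseteq> \<Union>\<P>\<close> unfolding \<P>_def by blast
    \<comment> \<open>Discarding countably many countable sets of stages leaves a stage
      \<open>\<xi>\<close> that belongs to \<open>above s\<close> for all \<open>s \<in> B\<close>
      at once.\<close>
    have "countable (\<Union>s\<in>B. omega1 - above s)"
      using B(1) BD unfolding D_def by (intro countable_UN) auto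
    then have "omega1 - (\<Union>s\<in>B. omega1 - above s) \<noteq> {}"
      by (rule uncountable_Diff_nonempty[OF uncountable_omega1])
    then obtain \<xi> where \<xi>: "\<xi> \<in> omega1" "\<And>s. s \<in> B \<Longrightarrow> \<xi> \<in> above s" by blast
    then have "\<forall>s\<in>B. \<exists>f. f \<in> F \<xi> \<and> f \<in> T \<and> s \<sqsubseteq> f" unfolding above_def by blast
    then obtain f where f: "\<And>s. s \<in> B \<Longrightarrow> f s \<in> F \<xi>" "\<And>s. s \<in> B \<Longrightarrow> f s \<in> T" "\<And>s. s \<in> B \<Longrightarrow> s \<sqsubseteq> f s"
      by metis
    \<comment> \<open>A common value of \<open>f\<close> lies above both nodes, which are then
      comparable, hence equal in the antichain. So the finite set \<open>F \<xi>\<close> would bound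
      the size of \<open>B\<close>.\<close>
    have "inj_on f B"
    proof (rule inj_onI)
      fix s t assume st: "s \<in> B" "t \<in> B" "f s = f t"
      have "s \<in> T" "t \<in> T" using st BD unfolding D_def by auto
      then have "s \<sqsubseteq> t \<or> t \<sqsubseteq> s"
        using le_linear[of s t "f s"] f(2)[OF st(1)] f(3)[OF st(1)] f(3)[OF st(2)] st(3) by simp
      moreover have "s \<in> A" "t \<in> A" using st B(3) by auto
      ultimately show "s = t" using anti by metis
    qed
    then have "finite B"
      using inj_on_finite[of f B "F \<xi>"] f(1) F(1)[OF \<xi>(1)] by blast
    then show False using B(2) by simp
  qed
  define \<K> where "\<K> = cone ` (T - D) \<union> (\<lambda>P. {P}) ` ({P \<in> paths. countable P} \<union> \<P>)"
  have K_cover: "\<Union>\<K> = paths"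
  proof
    show "\<Union>\<K> \<subseteq> paths" unfolding \<K>_def \<P>_def cone_def by blast
    show "paths \<subseteq> \<Union>\<K>"
    proof
      fix P assume P: "P \<in> paths"
      show "P \<in> \<Union>\<K>"
      proof (cases "countable P \<or> P \<in> \<P>")
        case True
        then have "{P} \<in> \<K>" unfolding \<K>_def using P by blast
        then show ?thesis by blast
      next
        case False
        then obtain s where s: "s \<in> P" "s \<notin> D" using P unfolding \<P>_def by blast
        then have "cone s \<in> \<K>" unfolding \<K>_def using path_subset[OF P] by blast
        moreover have "P \<in> cone s" using P s unfolding cone_def by simp
        ultimately show ?thesis by blast
      qed
    qed
  qed
  have img: "|f ` (UNIV :: (nat \<Rightarrow> 'a) set)| \<le>o cardSuc natLeq" for f :: "(nat \<Rightarrow> 'a) \<Rightarrow> 'b"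
    using ordLeq_transitive[OF card_of_image card] .
  \<comment> \<open>Cones are indexed by the first term of a sequence, nonempty countable paths by a
    sequence enumerating them; the empty path is not a range and is added separately.\<close>
  have "cone ` (T - D) \<subseteq> range (\<lambda>f :: nat \<Rightarrow> 'a. cone (f 0))"
  proof (rule image_subsetI)
    show "cone s \<in> range (\<lambda>f :: nat \<Rightarrow> 'a. cone (f 0))" for s
      by (rule image_eqI[of _ _ "\<lambda>_. s"]) simp_all
  qed
  moreover have "(\<lambda>P. {P}) ` {P \<in> paths. countable P} \<subseteq> range (\<lambda>f :: nat \<Rightarrow> 'a. {range f}) \<union> {{{}}}"
  proof (rule image_subsetI)
    fix P assume "P \<in> {P \<in> paths. countable P}"
    then have "P = {} \<or> P = range (from_nat_into P)" using range_from_nat_into[of P] by (cases "P = {}") simp_all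
    then show "{P} \<in> range (\<lambda>f :: nat \<Rightarrow> 'a. {range f}) \<union> {{{}}}"
    proof
      assume "P = range (from_nat_into P)"
      then show ?thesis by (intro UnI1 image_eqI[of _ _ "from_nat_into P"]) simp_all
    qed simp
  qed
  ultimately have "\<K> \<subseteq> (range (\<lambda>f :: nat \<Rightarrow> 'a. cone (f 0)) \<union>
      range (\<lambda>f :: nat \<Rightarrow> 'a. {range f})) \<union> ((\<lambda>P. {P}) ` \<P> \<union> {{{}}})"
    unfolding \<K>_def image_Un by auto
  moreover have "|(range (\<lambda>f :: nat \<Rightarrow> 'a. cone (f 0)) \<union> range (\<lambda>f :: nat \<Rightarrow> 'a. {range f})) \<union>
      ((\<lambda>P. {P}) ` \<P> \<union> {{{}}})| \<le>o cardSuc natLeq"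
    using \<open>finite \<P>\<close>
    by (intro Un_ordLeq_omega1 img countable_imp_ordLeq_omega1) (auto intro: countable_finite)
  ultimately have "|\<K>| \<le>o cardSuc natLeq"
    by (rule ordLeq_transitive[OF card_of_mono1])
  moreover have "uncountable (N K)" if "K \<in> \<K>" for K
    using that unfolding \<K>_def \<P>_def by (auto simp: N_cone N_point)
  ultimately have "\<exists>g. inj_on g \<K> \<and> (\<forall>K\<in>\<K>. g K \<in> N K)"
    by (rule inj_choice_omega1)
  \<comment> \<open>\<open>g\<close> reserves a separate stage for each piece.\<close>
  then obtain g where g: "inj_on g \<K>" "\<And>K. K \<in> \<K> \<Longrightarrow> g K \<in> N K" by auto
  have "\<exists>U. U \<in> \<U> \<xi> \<and> (\<forall>K\<in>\<K>. g K = \<xi> \<longrightarrow> K \<subseteq> U)" if \<xi>: "\<xi> \<in> omega1" for \<xi>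
  proof (cases "\<xi> \<in> g ` \<K>")
    case True
    then obtain K where K: "K \<in> \<K>" "\<xi> = g K" by blast
    then obtain U where U: "U \<in> \<U> \<xi>" "K \<subseteq> U" using g(2) unfolding N_def by blast
    have "K' = K" if "K' \<in> \<K>" "g K' = \<xi>" for K'
      using g(1) that K by (simp add: inj_on_eq_iff)
    then show ?thesis using U by metis
  next
    case False
    \<comment> \<open>A stage not reserved may take any member of its cover, which has one because
      the empty path must be covered.\<close>
    have "{} \<in> paths" by (simp add: paths_def)
    then obtain U where "U \<in> \<U> \<xi>" using un[OF \<xi>] by blast
    then show ?thesis using False by auto
  qed
  then obtain U where U: "\<And>\<xi>. \<xi> \<in> omega1 \<Longrightarrow> U \<xi> \<in> \<U> \<xi>"
      "\<And>\<xi> K. \<xi> \<in> omega1 \<Longrightarrow> K \<in> \<K> \<Longrightarrow> g K = \<xi> \<Longrightarrow> K \<subseteq> U \<xi>"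
    by metis
  have "paths \<subseteq> (\<Union>\<xi>\<in>omega1. U \<xi>)"
  proof
    fix P assume "P \<in> paths"
    then obtain K where K: "K \<in> \<K>" "P \<in> K" using K_cover by blast
    have "g K \<in> omega1" using g(2)[OF K(1)] unfolding N_def by simp
    then show "P \<in> (\<Union>\<xi>\<in>omega1. U \<xi>)" using U(2)[OF _ K(1)] K(2) by blast
  qed
  moreover have "(\<Union>\<xi>\<in>omega1. U \<xi>) \<subseteq> paths" using U(1) un by blast
  ultimately show "\<exists>U. (\<forall>\<xi>\<in>omega1. U \<xi> \<in> \<U> \<xi>) \<and> paths = (\<Union>\<xi>\<in>omega1. U \<xi>)"
    using U(1) by blast
qed

end

unbundle no cardinal_syntax


section \<open>Forcing with a tree\<close>

context tree
begin

text \<open>The forcing notion is the tree, copied into the type of conditions by \<open>e\<close>,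
  with higher nodes stronger. A path cannot contain two incomparable nodes, so \<open>split\<close>
  yields an extension off any given path.\<close>

lemma destructible_path_space:
  fixes e :: "'a \<Rightarrow> 'p"
  assumes inj: "inj_on e T" and nonempty: "T \<noteq> {}"
    and closed: "\<And>(w :: nat rel) f. Well_order w \<Longrightarrow> (\<And>i. i \<in> Field w \<Longrightarrow> f i \<in> T) \<Longrightarrow>
      (\<And>i j. (i, j) \<in> w \<Longrightarrow> f i \<sqsubseteq> f j) \<Longrightarrow> \<exists>t\<in>T. \<forall>i\<in>Field w. f i \<sqsubseteq> t"
    and split: "\<And>t. t \<in> T \<Longrightarrow> \<exists>u\<in>T. \<exists>v\<in>T. t \<sqsubseteq> u \<and> t \<sqsubseteq> v \<and> \<not> u \<sqsubseteq> v \<and> \<not> v \<sqsubseteq> u"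
  shows "destructible TYPE('p) path_space"
proof -
  define r where "r = {(e t, e s) |s t. s \<in> T \<and> t \<in> T \<and> s \<sqsubseteq> t}"
  have r_iff: "(e t, e s) \<in> r \<longleftrightarrow> s \<sqsubseteq> t" if "s \<in> T" "t \<in> T" for s t
    unfolding r_def using that inj by (auto dest: inj_onD)
  have r_sub: "r \<subseteq> e ` T \<times> e ` T" by (auto simp: r_def)
  have Field_r: "Field r = e ` T"
  proof
    show "Field r \<subseteq> e ` T" using r_sub by (auto simp: Field_def)
    show "e ` T \<subseteq> Field r" using r_iff le_refl by (auto intro: FieldI1)
  qed
  have "Preorder r"
    unfolding preorder_on_def Field_r
  proof (intro conjI)
    show "refl_on (e ` T) r" using r_iff le_refl by (auto simp: refl_on_def)
    show "trans r"
    proof (rule transI)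
      fix x y z assume xy: "(x, y) \<in> r" and yz: "(y, z) \<in> r"
      then obtain s t u where "x = e s" "y = e t" "z = e u" and T: "s \<in> T" "t \<in> T" "u \<in> T"
        using r_sub by blast
      then show "(x, z) \<in> r"
        using xy yz r_iff le_trans[of u t s] by simp
    qed
  qed (rule r_sub)
  then interpret forcing r by unfold_locales
  have closed_r: "countably_closed r"
    unfolding countably_closed_def
  proof (intro allI impI)
    fix w :: "nat rel" and f
    assume w: "Well_order w" and f: "\<forall>i\<in>Field w. f i \<in> Field r"
      and desc: "\<forall>i j. (i, j) \<in> w \<longrightarrow> (f j, f i) \<in> r"
    define g where "g = inv_into T e \<circ> f"
    have g: "g i \<in> T" "e (g i) = f i" if "i \<in> Field w" for i
      using f that unfolding g_def Field_r by (simp_all add: inv_into_into f_inv_into_f)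
    have "g i \<sqsubseteq> g j" if ij: "(i, j) \<in> w" for i j
    proof -
      have "i \<in> Field w" "j \<in> Field w" using ij by (auto intro: FieldI1 FieldI2)
      then show ?thesis using g desc ij r_iff by metis
    qed
    then obtain t where t: "t \<in> T" "\<forall>i\<in>Field w. g i \<sqsubseteq> t"
      using closed[OF w, of g] g(1) by auto
    have "(e t, f i) \<in> r" if i: "i \<in> Field w" for i
      using r_iff[OF g(1)[OF i] t(1)] t(2) i g(2)[OF i] by auto
    then show "\<exists>p\<in>Field r. \<forall>i\<in>Field w. (p, f i) \<in> r"
      using t(1) unfolding Field_r by auto
  qed
  define A where "A = (\<lambda>c. {P \<in> paths. inv_into T e c \<notin> P})"
  have A_e: "A (e t) = {P \<in> paths. t \<notin> P}" if "t \<in> T" for t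
    using inj that by (simp add: A_def)
  have cover: "\<exists>q. (q, p) \<in> r \<and> x \<in> A q" if x: "x \<in> topspace path_space" and p: "p \<in> Field r" for x p
  proof -
    have x': "x \<in> paths" using x by simp
    obtain t where t: "t \<in> T" "p = e t" using p unfolding Field_r by blast
    obtain u v where uv: "u \<in> T" "v \<in> T" "t \<sqsubseteq> u" "t \<sqsubseteq> v" "\<not> u \<sqsubseteq> v" "\<not> v \<sqsubseteq> u"
      using split[OF t(1)] by blast
    have "u \<notin> x \<or> v \<notin> x" using path_linear[OF x'] uv(5,6) by auto
    then show ?thesis
    proof
      assume "u \<notin> x"
      then show ?thesis using A_e[OF uv(1)] r_iff[OF t(1) uv(1)] uv(3) t(2) x' by auto
    next
      assume "v \<notin> x"
      then show ?thesis using A_e[OF uv(2)] r_iff[OF t(1) uv(2)] uv(4) t(2) x' by auto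
    qed
  qed
  have miss: "\<exists>x\<in>topspace path_space. \<forall>c. (p, c) \<in> r \<longrightarrow> x \<notin> A c" if p: "p \<in> Field r" for p
  proof -
    obtain t where t: "t \<in> T" "p = e t" using p unfolding Field_r by blast
    \<comment> \<open>The conditions weaker than \<open>e t\<close> come from nodes below
      \<open>t\<close>, and the path ending at \<open>t\<close> contains all of them.\<close>
    have "{s \<in> T. s \<sqsubseteq> t} \<notin> A c" if pc: "(p, c) \<in> r" for c
    proof -
      obtain s where s: "s \<in> T" "c = e s" using pc r_sub by blast
      then show ?thesis using A_e[OF s(1)] r_iff[OF s(1) t(1)] pc t(2) by simp
    qed
    then show ?thesis using predecessors_path[OF t(1)] by (intro bexI[of _ "{s \<in> T. s \<sqsubseteq> t}"]) simp_all
  qed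
  obtain p where p: "p \<in> Field r" using nonempty Field_r by blast
  have A_open: "openin path_space (A c)" for c
    unfolding A_def by (rule openin_path_space_avoiding)
  have "\<not> fLindelof path_space r p"
    by (rule not_fLindelof[OF closed_r A_open cover miss p])
  moreover have "forcing_notion r"
    using \<open>Preorder r\<close> p unfolding forcing_notion_def by blast
  ultimately show ?thesis
    unfolding destructible_def indestructible_def
    using closed_r p compact_imp_Lindelof_space[OF compact_space_path_space] by blast
qed

text \<open>Allows the nodes to be replaced by codes from a smaller type.\<close>

lemma tree_image:
  assumes d: "\<And>t. t \<in> T \<Longrightarrow> d (e t) = t"
  shows "tree (e ` T) (\<lambda>s t. d s \<sqsubseteq> d t)"
proof
  show "d s \<sqsubseteq> d s" if "s \<in> e ` T" for s
    using that d le_refl by auto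
  show "d s \<sqsubseteq> d u" if "s \<in> e ` T" "t \<in> e ` T" "u \<in> e ` T" "d s \<sqsubseteq> d t" "d t \<sqsubseteq> d u" for s t u
    using le_trans[of "d s" "d t" "d u"] that d by auto
  show "d s \<sqsubseteq> d t \<or> d t \<sqsubseteq> d s"
    if "s \<in> e ` T" "t \<in> e ` T" "u \<in> e ` T" "d s \<sqsubseteq> d u" "d t \<sqsubseteq> d u" for s t u
    using le_linear[of "d s" "d t" "d u"] that d by auto
  show "countable {s \<in> e ` T. d s \<sqsubseteq> d t}" if "t \<in> e ` T" for t
  proof -
    have "{s \<in> e ` T. d s \<sqsubseteq> d t} \<subseteq> e ` {s \<in> T. s \<sqsubseteq> d t}" using d by auto
    moreover have "d t \<in> T" using that d by auto
    ultimately show ?thesis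
      using countable_predecessors countable_image countable_subset by metis
  qed
qed

end

section \<open>The tree of countable subsets of omega one\<close>

definition end_extension :: "'a rel \<Rightarrow> 'a set \<Rightarrow> 'a set \<Rightarrow> bool" where
  "end_extension r a b \<longleftrightarrow> a \<subseteq> b \<and> (\<forall>x\<in>b - a. \<forall>y\<in>a. (y, x) \<in> r)"

text \<open>Excluding the empty set makes every node the range of a sequence, which is how
  \<open>encode\<close> represents it.\<close>

definition nodes :: "nat set set set" where
  "nodes = {a. a \<subseteq> omega1 \<and> countable a \<and> a \<noteq> {}}"

abbreviation node_le :: "nat set set \<Rightarrow> nat set set \<Rightarrow> bool" where
  "node_le \<equiv> end_extension (cardSuc natLeq)"

lemma omega1_antisym: "(x, y) \<in> cardSuc natLeq \<Longrightarrow> (y, x) \<in> cardSuc natLeq \<Longrightarrow> x = y"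
  using Well_order_omega1
  unfolding well_order_on_def linear_order_on_def partial_order_on_def by (meson antisymD)

lemma omega1_total:
  "x \<in> omega1 \<Longrightarrow> y \<in> omega1 \<Longrightarrow> x \<noteq> y \<Longrightarrow> (x, y) \<in> cardSuc natLeq \<or> (y, x) \<in> cardSuc natLeq"
  using Well_order_omega1
  unfolding omega1_def well_order_on_def linear_order_on_def total_on_def by blast

text \<open>The predecessors of \<open>c\<close> are initial segments of \<open>c\<close>, hence
  nested. A proper one, \<open>a\<close>, is cut off by the least element of \<open>c - a\<close>,
  so apart from \<open>c\<close> there are at most as many as elements of \<open>c\<close>.\<close>

lemma tree_nodes: "tree nodes node_le"
proof
  show "node_le a a" if "a \<in> nodes" for a
    by (simp add: end_extension_def)
  show "node_le a c" if "node_le a b" "node_le b c" for a b c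
    using that unfolding end_extension_def by blast
  show "node_le a b \<or> node_le b a" if ac: "node_le a c" and bc: "node_le b c" for a b c
  proof (cases "a \<subseteq> b")
    case True
    then show ?thesis using ac bc unfolding end_extension_def by blast
  next
    case False
    then obtain x where x: "x \<in> a" "x \<notin> b" by blast
    have "y \<in> a" if y: "y \<in> b" for y
    proof (rule ccontr)
      assume ya: "y \<notin> a"
      \<comment> \<open>Inside \<open>c\<close>, the element \<open>x\<close> of
        \<open>a - b\<close> comes after all of \<open>b\<close>, and \<open>y\<close> of
        \<open>b - a\<close> after all of \<open>a\<close>.\<close>
      have "(y, x) \<in> cardSuc natLeq" "(x, y) \<in> cardSuc natLeq"
        using ac bc x y ya unfolding end_extension_def by auto
      then show False using omega1_antisym x y by metis
    qed
    then have "b \<subseteq> a" by blast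
    then show ?thesis using ac bc unfolding end_extension_def by blast
  qed
  show "countable {a \<in> nodes. node_le a c}" if c: "c \<in> nodes" for c
  proof -
    have "a \<in> insert c ((\<lambda>x. c \<inter> underS (cardSuc natLeq) x) ` c)" if ac: "node_le a c" for a
    proof (cases "a = c")
      case False
      then obtain x0 where "x0 \<in> c - a" using ac unfolding end_extension_def by blast
      moreover have "wf (cardSuc natLeq - Id :: nat set rel)"
        using Well_order_omega1 unfolding well_order_on_def by blast
      ultimately obtain x where x: "x \<in> c - a" "\<And>y. (y, x) \<in> cardSuc natLeq - Id \<Longrightarrow> y \<notin> c - a"
        by (metis wfE_min)
      have "a = c \<inter> underS (cardSuc natLeq) x"
      proof (intro set_eqI iffI)
        fix y assume "y \<in> a"
        then show "y \<in> c \<inter> underS (cardSuc natLeq) x"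
          using ac x(1) unfolding end_extension_def underS_def by auto
      next
        fix y assume "y \<in> c \<inter> underS (cardSuc natLeq) x"
        then show "y \<in> a" using x(2)[of y] unfolding underS_def by auto
      qed
      then show ?thesis using x(1) by blast
    qed simp
    then have "{a \<in> nodes. node_le a c} \<subseteq> insert c ((\<lambda>x. c \<inter> underS (cardSuc natLeq) x) ` c)"
      by blast
    moreover have "countable c" using c by (simp add: nodes_def)
    ultimately show ?thesis by (meson countable_image countable_insert countable_subset)
  qed
qed

text \<open>Only countably many elements of \<open>omega1\<close> belong to \<open>a\<close> or
  precede an element of it; any other one is a bound.\<close>

lemma omega1_strict_upper_bound:
  assumes "a \<subseteq> omega1" "countable a"
  shows "\<exists>x\<in>omega1. x \<notin> a \<and> (\<forall>y\<in>a. (y, x) \<in> cardSuc natLeq)"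
proof -
  have "countable (a \<union> (\<Union>y\<in>a. underS (cardSuc natLeq) y))"
    using assms(2) by (intro countable_Un countable_UN countable_underS_omega1)
  then have "omega1 - (a \<union> (\<Union>y\<in>a. underS (cardSuc natLeq) y)) \<noteq> {}"
    by (rule uncountable_Diff_nonempty[OF uncountable_omega1])
  then obtain x where x: "x \<in> omega1" "x \<notin> a" "\<And>y. y \<in> a \<Longrightarrow> x \<notin> underS (cardSuc natLeq) y"
    by blast
  have "(y, x) \<in> cardSuc natLeq" if y: "y \<in> a" for y
  proof -
    have "y \<noteq> x" "y \<in> omega1" using x(2) y assms(1) by auto
    then show ?thesis using omega1_total[OF x(1), of y] x(3)[OF y] by (auto simp: underS_def)
  qed
  then show ?thesis using x by blast
qed

text \<open>Two different elements beyond \<open>a\<close> are appended separately; neither result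
  contains the other.\<close>

lemma nodes_split:
  assumes a: "a \<in> nodes"
  shows "\<exists>b\<in>nodes. \<exists>c\<in>nodes. node_le a b \<and> node_le a c \<and> \<not> node_le b c \<and> \<not> node_le c b"
proof -
  have a': "a \<subseteq> omega1" "countable a" using a by (auto simp: nodes_def)
  obtain x where x: "x \<in> omega1" "x \<notin> a" "\<forall>y\<in>a. (y, x) \<in> cardSuc natLeq"
    using omega1_strict_upper_bound[OF a'] by blast
  have "insert x a \<subseteq> omega1" "countable (insert x a)" using a' x by auto
  then obtain z where z: "z \<in> omega1" "z \<notin> insert x a" "\<forall>y\<in>insert x a. (y, z) \<in> cardSuc natLeq"
    using omega1_strict_upper_bound by meson
  have "insert x a \<in> nodes" "insert z a \<in> nodes" using a' x(1) z(1) by (auto simp: nodes_def)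
  moreover have "node_le a (insert x a)" "node_le a (insert z a)"
    using x z by (auto simp: end_extension_def)
  moreover have "\<not> node_le (insert x a) (insert z a)" "\<not> node_le (insert z a) (insert x a)"
    using x z by (auto simp: end_extension_def)
  ultimately show ?thesis by blast
qed

lemma nodes_nonempty: "nodes \<noteq> {}"
proof -
  obtain x where "x \<in> omega1" using omega1_strict_upper_bound[of "{}"] by auto
  then have "{x} \<in> nodes" by (simp add: nodes_def)
  then show ?thesis by blast
qed

text \<open>The union of a countable chain is countable and end-extends each term, since a new
  element already appears in a later term. The empty chain is bounded by any node.\<close>

lemma nodes_closed:
  fixes w :: "nat rel"
  assumes w: "Well_order w" and f: "\<And>i. i \<in> Field w \<Longrightarrow> f i \<in> nodes"
    and mono: "\<And>i j. (i, j) \<in> w \<Longrightarrow> node_le (f i) (f j)"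
  shows "\<exists>a\<in>nodes. \<forall>i\<in>Field w. node_le (f i) a"
proof (cases "Field w = {}")
  case True
  then show ?thesis using nodes_nonempty by auto
next
  case False
  let ?a = "\<Union>i\<in>Field w. f i"
  have f': "f i \<subseteq> omega1" "countable (f i)" "f i \<noteq> {}" if "i \<in> Field w" for i
    using f[OF that] by (auto simp: nodes_def)
  have "?a \<noteq> {}" using False f'(3) by auto
  moreover have "?a \<subseteq> omega1" using f'(1) by blast
  moreover have "countable ?a" using f'(2) by (intro countable_UN) auto
  ultimately have "?a \<in> nodes" by (simp add: nodes_def)
  moreover have "node_le (f i) ?a" if i: "i \<in> Field w" for i
    unfolding end_extension_def
  proof (intro conjI ballI)
    show "f i \<subseteq> ?a" using i by blast
    fix x y assume x: "x \<in> ?a - f i" and y: "y \<in> f i"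
    then obtain j where j: "j \<in> Field w" "x \<in> f j" by blast
    have "i \<noteq> j" using x j(2) by blast
    then have "(i, j) \<in> w \<or> (j, i) \<in> w"
      using w i j(1) unfolding well_order_on_def linear_order_on_def total_on_def by blast
    moreover have "(j, i) \<notin> w" using mono[of j i] x j(2) unfolding end_extension_def by blast
    ultimately have "node_le (f i) (f j)" using mono by blast
    then show "(y, x) \<in> cardSuc natLeq" using x y j(2) unfolding end_extension_def by blast
  qed
  ultimately show ?thesis by blast
qed

section \<open>Coding nodes by sets of natural numbers\<close>

definition interleave :: "(nat \<Rightarrow> nat set) \<Rightarrow> nat set" where
  "interleave f = {prod_encode (n, m) |n m. m \<in> f n}"

definition row :: "nat set \<Rightarrow> nat \<Rightarrow> nat set" where
  "row S n = {m. prod_encode (n, m) \<in> S}"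

lemma row_interleave: "row (interleave f) = f"
  by (auto simp: row_def interleave_def fun_eq_iff)

unbundle cardinal_syntax

lemma card_of_nat_set_sequences: "|UNIV :: (nat \<Rightarrow> nat set) set| \<le>o |UNIV :: nat set set|"
  unfolding card_of_ordLeq[symmetric] using inj_on_inverseI[of UNIV row interleave] row_interleave by blast

lemma CH_card_of_nat_set_sequences:
  assumes CH
  shows "|UNIV :: (nat \<Rightarrow> nat set) set| \<le>o cardSuc natLeq"
proof -
  have "|UNIV :: nat set set| =o |UNIV :: real set|"
    using nat_sets_eqpoll_reals by (simp add: eqpoll_iff_card_of_ordIso)
  then have "|UNIV :: nat set set| =o cardSuc natLeq"
    using assms unfolding CH_def by (rule ordIso_transitive)
  then show ?thesis
    using card_of_nat_set_sequences by (rule ordLeq_ordIso_trans[rotated])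
qed

unbundle no cardinal_syntax

text \<open>Coding a node as one set of naturals brings the sequences of nodes down to continuum
  many, which CH turns into aleph one.\<close>

definition encode :: "nat set set \<Rightarrow> nat set" where
  "encode a = interleave (from_nat_into a)"

definition decode :: "nat set \<Rightarrow> nat set set" where
  "decode S = range (row S)"

lemma decode_encode: "a \<in> nodes \<Longrightarrow> decode (encode a) = a"
  by (simp add: nodes_def decode_def encode_def row_interleave)

section \<open>The path space of the coded tree\<close>

theorem theorem1p9:
  shows "\<exists>X :: nat set set topology.
    compact_space X \<and> Hausdorff_space X \<and>
    destructible TYPE(nat set set set) X \<and>
    (CH \<longrightarrow> S1_omega1 X)"
proof -
  let ?T = "encode ` nodes" and ?le = "\<lambda>s t. node_le (decode s) (decode t)"
  interpret nodes: tree nodes node_le by (rule tree_nodes)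
  interpret tree ?T ?le by (rule nodes.tree_image) (rule decode_encode)
  have "destructible TYPE(nat set set set) path_space"
  \<comment> \<open>\<open>{{t}}\<close> serves as an injection of the codes into the type of
    conditions.\<close>
  proof (rule destructible_path_space[of "\<lambda>t. {{t}}"])
    show "inj_on (\<lambda>t. {{t}}) ?T" by (simp add: inj_on_def)
    show "?T \<noteq> {}" using nodes_nonempty by simp
    show "\<exists>t\<in>?T. \<forall>i\<in>Field w. ?le (f i) t"
      if w: "Well_order w" and f: "\<And>i. i \<in> Field w \<Longrightarrow> f i \<in> ?T"
        and mono: "\<And>i j. (i, j) \<in> w \<Longrightarrow> ?le (f i) (f j)" for w :: "nat rel" and f
    proof -
      have "decode (f i) \<in> nodes" if "i \<in> Field w" for i
        using f[OF that] decode_encode by auto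
      then have "\<exists>a\<in>nodes. \<forall>i\<in>Field w. node_le (decode (f i)) a"
        using mono by (intro nodes_closed[OF w])
      then show ?thesis using decode_encode by auto
    qed
    show "\<exists>u\<in>?T. \<exists>v\<in>?T. ?le t u \<and> ?le t v \<and> \<not> ?le u v \<and> \<not> ?le v u" if t: "t \<in> ?T" for t
    proof -
      obtain a where a: "a \<in> nodes" "t = encode a" using t by blast
      obtain b c where "b \<in> nodes" "c \<in> nodes" "node_le a b" "node_le a c" "\<not> node_le b c" "\<not> node_le c b"
        using nodes_split[OF a(1)] by blast
      then show ?thesis
        using a decode_encode by (intro bexI[of _ "encode b"] bexI[of _ "encode c"]) simp_all
    qed
  qed
  moreover have "CH \<longrightarrow> S1_omega1 path_space"
    using S1_omega1_path_space[OF CH_card_of_nat_set_sequences] by blast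
  ultimately show ?thesis
    using compact_space_path_space Hausdorff_space_path_space by blast
qed

end
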